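(* Let $G$ be a free product of two groups amalgamated over a finite subgroup $T$, and let $H,K\subseteq G$ be finitely generated subgroups which intersect trivially all the conjugates in $G$ of the two factors of $G$ (and are, therefore, free). Then $$\overline{r}(H\cap K)\leqslant 6m\cdot\overline{r}(H)\,\overline{r}(K),\qquad\text{where } m=\max_{g\in G}|g^{-1}Tg\cap HK|.$$ In particular, $$\overline{r}(H\cap K)\leqslant 6|T|\cdot\overline{r}(H)\,\overline{r}(K).$$
   Context: For a free group $F$, $r(F)$ denotes its rank and $\overline{r}(F)=\max(r(F)-1,0)$ its reduced rank. $HK=\{hk: h\in H,k\in K\}$ (a subset of $G$, not necessarily a subgroup). The factors and the amalgamated subgroup $T$ are regarded as subgroups of the amalgamated free product $G$. *)

theory Defs
  imports "HOL-Algebra.Generated_Groups" "HOL-Library.Extended_Nat"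
begin

definition letter_val :: "('a, 'b) monoid_scheme \<Rightarrow> 'a \<times> bool \<Rightarrow> 'a" where
  "letter_val F l = (if snd l then fst l else inv\<^bsub>F\<^esub> (fst l))"

definition reduced_words :: "'a set \<Rightarrow> ('a \<times> bool) list set" where
  "reduced_words X =
     {w \<in> lists (X \<times> UNIV). successively (\<lambda>k l. \<not> (fst k = fst l \<and> snd k \<noteq> snd l)) w}"

definition word_val :: "('a, 'b) monoid_scheme \<Rightarrow> ('a \<times> bool) list \<Rightarrow> 'a" where
  "word_val F w = foldr (\<lambda>l p. letter_val F l \<otimes>\<^bsub>F\<^esub> p) w \<one>\<^bsub>F\<^esub>"

text \<open>A group is free on \<open>X\<close> if each of its elements is the value of exactly one reduced word in
  \<open>X\<close> and the inverses of \<open>X\<close>. The pair \<open>(x, True)\<close> encodes the letter \<open>x\<close>, and \<open>(x, False)\<close>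
  encodes the formal inverse of \<open>x\<close>.\<close>

definition free_basis :: "('a, 'b) monoid_scheme \<Rightarrow> 'a set \<Rightarrow> bool" where
  "free_basis F X \<longleftrightarrow>
     group F \<and> X \<subseteq> carrier F \<and> bij_betw (word_val F) (reduced_words X) (carrier F)"

definition free_group :: "('a, 'b) monoid_scheme \<Rightarrow> bool" where
  "free_group F \<longleftrightarrow> (\<exists>X. free_basis F X)"

text \<open>The rank is only meaningful for free groups. All bases of a free group have the same
  cardinality, so the infimum merely selects their common value; infinite ranks are
  identified with \<open>\<infinity>\<close>.\<close>

definition free_rank :: "('a, 'b) monoid_scheme \<Rightarrow> enat" where
  "free_rank F = (INF X \<in> {X. free_basis F X}. if finite X then enat (card X) else \<infinity>)"

definition reduced_rank :: "('a, 'b) monoid_scheme \<Rightarrow> enat" where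
  "reduced_rank F = max (free_rank F - 1) 0"

definition fin_gen_subgroup :: "'a set \<Rightarrow> ('a, 'b) monoid_scheme \<Rightarrow> bool" where
  "fin_gen_subgroup H G \<longleftrightarrow>
     subgroup H G \<and> (\<exists>S. finite S \<and> S \<subseteq> carrier G \<and> H = generate G S)"

text \<open>The free product of \<open>A\<close> and \<open>B\<close> amalgamated over \<open>T\<close> consists of the words over the
  disjoint union of \<open>A\<close> and \<open>B\<close> modulo the equivalence generated by the following steps:
  two adjacent letters of the same factor are multiplied in that factor, trivial letters are
  deleted, and the two copies of an element of \<open>T\<close> are identified.\<close>

inductive amalg_step ::
  "('a, 'b) monoid_scheme \<Rightarrow> 'a set \<Rightarrow> 'a set \<Rightarrow> 'a set \<Rightarrow> ('a + 'a) list \<Rightarrow> ('a + 'a) list \<Rightarrow> bool"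
  for G A B T where
  mult_left: "x \<in> A \<Longrightarrow> y \<in> A \<Longrightarrow>
     amalg_step G A B T (u @ [Inl x, Inl y] @ v) (u @ [Inl (x \<otimes>\<^bsub>G\<^esub> y)] @ v)"
| mult_right: "x \<in> B \<Longrightarrow> y \<in> B \<Longrightarrow>
     amalg_step G A B T (u @ [Inr x, Inr y] @ v) (u @ [Inr (x \<otimes>\<^bsub>G\<^esub> y)] @ v)"
| one_left: "amalg_step G A B T (u @ [Inl \<one>\<^bsub>G\<^esub>] @ v) (u @ v)"
| one_right: "amalg_step G A B T (u @ [Inr \<one>\<^bsub>G\<^esub>] @ v) (u @ v)"
| identify: "t \<in> T \<Longrightarrow> amalg_step G A B T (u @ [Inl t] @ v) (u @ [Inr t] @ v)"

definition amalg_val :: "('a, 'c) monoid_scheme \<Rightarrow> ('b \<Rightarrow> 'a) \<Rightarrow> ('b \<Rightarrow> 'a) \<Rightarrow> ('b + 'b) list \<Rightarrow> 'a" where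
  "amalg_val L f g w = foldr (\<lambda>l p. case_sum f g l \<otimes>\<^bsub>L\<^esub> p) w \<one>\<^bsub>L\<^esub>"

text \<open>The last two conjuncts say that the canonical map from this quotient to \<open>G\<close>, induced by
  the inclusions of \<open>A\<close> and \<open>B\<close>, is surjective, well defined and injective, i.e. an
  isomorphism. Hence \<open>A \<inter> B = T\<close> need not be required separately.\<close>

definition amalgamated_free_product ::
  "('a, 'b) monoid_scheme \<Rightarrow> 'a set \<Rightarrow> 'a set \<Rightarrow> 'a set \<Rightarrow> bool" where
  "amalgamated_free_product G A B T \<longleftrightarrow>
     group G \<and> subgroup A G \<and> subgroup B G \<and> subgroup T G \<and> T \<subseteq> A \<and> T \<subseteq> B \<and>
     amalg_val G id id ` lists (A <+> B) = carrier G \<and>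
     (\<forall>u \<in> lists (A <+> B). \<forall>v \<in> lists (A <+> B).
        amalg_val G id id u = amalg_val G id id v \<longleftrightarrow> equivclp (amalg_step G A B T) u v)"

text \<open>As a check of the definition, the universal property of the pushout follows from it.\<close>

lemma amalg_val_simps [simp]:
  "amalg_val L f g [] = \<one>\<^bsub>L\<^esub>"
  "amalg_val L f g (l # w) = case_sum f g l \<otimes>\<^bsub>L\<^esub> amalg_val L f g w"
  by (simp_all add: amalg_val_def)

lemma amalg_val_closed:
  assumes "group L" "f \<in> A \<rightarrow> carrier L" "g \<in> B \<rightarrow> carrier L" "w \<in> lists (A <+> B)"
  shows "amalg_val L f g w \<in> carrier L"
proof -
  interpret L: group L by fact
  show ?thesis using assms(4) by induction (use assms(2,3) in \<open>auto intro!: L.m_closed\<close>)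
qed

lemma amalg_val_append:
  assumes "group L" "f \<in> A \<rightarrow> carrier L" "g \<in> B \<rightarrow> carrier L"
    and "u \<in> lists (A <+> B)" "v \<in> lists (A <+> B)"
  shows "amalg_val L f g (u @ v) = amalg_val L f g u \<otimes>\<^bsub>L\<^esub> amalg_val L f g v"
proof -
  interpret L: group L by fact
  note cl = amalg_val_closed[OF assms(1-3)]
  show ?thesis using assms(4)
  proof induction
    case (Cons l w)
    have "case_sum f g l \<in> carrier L" using Cons(1) assms(2,3) by auto
    then show ?case using Cons cl[OF Cons(2)] cl[OF assms(5)] by (simp add: L.m_assoc)
  qed (use cl[OF assms(5)] in simp)
qed

lemma amalg_step_val:
  assumes L: "group L" and G: "group G" "subgroup A G" "subgroup B G" "T \<subseteq> A" "T \<subseteq> B"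
    and f: "f \<in> hom (G\<lparr>carrier := A\<rparr>) L" and g: "g \<in> hom (G\<lparr>carrier := B\<rparr>) L"
    and fg: "\<And>t. t \<in> T \<Longrightarrow> f t = g t"
    and st: "amalg_step G A B T u v"
  shows "u \<in> lists (A <+> B) \<longleftrightarrow> v \<in> lists (A <+> B)"
    and "u \<in> lists (A <+> B) \<Longrightarrow> amalg_val L f g u = amalg_val L f g v"
proof -
  interpret G: group G by fact
  interpret L: group L by fact
  interpret A: subgroup A G by fact
  interpret B: subgroup B G by fact
  have fA: "f \<in> A \<rightarrow> carrier L" and gB: "g \<in> B \<rightarrow> carrier L"
    using f g by (auto simp: hom_def)
  have fm: "f (x \<otimes>\<^bsub>G\<^esub> y) = f x \<otimes>\<^bsub>L\<^esub> f y" if "x \<in> A" "y \<in> A" for x y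
    using f that by (auto simp: hom_def)
  have gm: "g (x \<otimes>\<^bsub>G\<^esub> y) = g x \<otimes>\<^bsub>L\<^esub> g y" if "x \<in> B" "y \<in> B" for x y
    using g that by (auto simp: hom_def)
  have f1: "f \<one>\<^bsub>G\<^esub> = \<one>\<^bsub>L\<^esub>" using fm[of "\<one>\<^bsub>G\<^esub>" "\<one>\<^bsub>G\<^esub>"] fA
    by (metis A.one_closed G.l_one G.one_closed L.r_cancel_one' PiE)
  have g1: "g \<one>\<^bsub>G\<^esub> = \<one>\<^bsub>L\<^esub>" using gm[of "\<one>\<^bsub>G\<^esub>" "\<one>\<^bsub>G\<^esub>"] gB
    by (metis B.one_closed G.l_one G.one_closed L.r_cancel_one' PiE)
  show "u \<in> lists (A <+> B) \<longleftrightarrow> v \<in> lists (A <+> B)"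
    using st G(4,5) by cases auto
  note ap = amalg_val_append[OF L fA gB] and cl = amalg_val_closed[OF L fA gB]
  show "amalg_val L f g u = amalg_val L f g v" if "u \<in> lists (A <+> B)"
    using st
  proof cases
    case (mult_left x y u' v')
    then show ?thesis using that cl[of v'] funcset_mem[OF fA]
      by (simp add: ap[of u'] fm L.m_assoc InlI)
  next
    case (mult_right x y u' v')
    then show ?thesis using that cl[of v'] funcset_mem[OF gB]
      by (simp add: ap[of u'] gm L.m_assoc InrI)
  next
    case (one_left u' v')
    then show ?thesis using that cl[of v'] by (simp add: ap[of u'] f1 InlI)
  next
    case (one_right u' v')
    then show ?thesis using that cl[of v'] by (simp add: ap[of u'] g1 InrI)
  next
    case (identify t u' v')
    then show ?thesis using that G(4,5) fg by (simp add: ap[of u'] InlI InrI subset_iff)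
  qed
qed

lemma amalgamated_free_product_universal:
  assumes am: "amalgamated_free_product G A B T" and L: "group L"
    and f: "f \<in> hom (G\<lparr>carrier := A\<rparr>) L" and g: "g \<in> hom (G\<lparr>carrier := B\<rparr>) L"
    and fg: "\<And>t. t \<in> T \<Longrightarrow> f t = g t"
  shows "\<exists>h \<in> hom G L. (\<forall>a \<in> A. h a = f a) \<and> (\<forall>b \<in> B. h b = g b) \<and>
           (\<forall>h' \<in> hom G L. (\<forall>a \<in> A. h' a = f a) \<and> (\<forall>b \<in> B. h' b = g b) \<longrightarrow>
              (\<forall>x \<in> carrier G. h' x = h x))"
proof -
  have G: "group G" "subgroup A G" "subgroup B G" "T \<subseteq> A" "T \<subseteq> B"
    and sur: "amalg_val G id id ` lists (A <+> B) = carrier G"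
    and inj: "\<And>u v. u \<in> lists (A <+> B) \<Longrightarrow> v \<in> lists (A <+> B) \<Longrightarrow>
        amalg_val G id id u = amalg_val G id id v \<longleftrightarrow> equivclp (amalg_step G A B T) u v"
    using am by (auto simp: amalgamated_free_product_def)
  interpret G: group G by fact
  interpret L: group L by fact
  interpret A: subgroup A G by fact
  interpret B: subgroup B G by fact
  have fA: "f \<in> A \<rightarrow> carrier L" and gB: "g \<in> B \<rightarrow> carrier L"
    using f g by (auto simp: hom_def)
  have iA: "id \<in> A \<rightarrow> carrier G" and iB: "id \<in> B \<rightarrow> carrier G" by auto
  note stv = amalg_step_val[OF L G f g fg]
  have eq: "v \<in> lists (A <+> B) \<and> amalg_val L f g u = amalg_val L f g v"
    if "equivclp (amalg_step G A B T) u v" "u \<in> lists (A <+> B)" for u v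
    using that(1)
  proof (induction rule: equivclp_induct)
    case base
    then show ?case using that(2) by simp
  next
    case (step y z)
    then show ?case using stv by metis
  qed
  define wd where "wd x = (SOME w. w \<in> lists (A <+> B) \<and> amalg_val G id id w = x)" for x
  define h where "h x = amalg_val L f g (wd x)" for x
  have wd: "wd x \<in> lists (A <+> B) \<and> amalg_val G id id (wd x) = x" if "x \<in> carrier G" for x
  proof -
    have "\<exists>w. w \<in> lists (A <+> B) \<and> amalg_val G id id w = x" using that unfolding sur[symmetric] by blast
    then show ?thesis unfolding wd_def by (rule someI_ex)
  qed
  note clG = amalg_val_closed[OF G(1) iA iB] and clL = amalg_val_closed[OF L fA gB]
  have hv: "h (amalg_val G id id w) = amalg_val L f g w" if "w \<in> lists (A <+> B)" for w
    unfolding h_def using wd[OF clG[OF that]] inj eq that by metis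
  have hom: "h \<in> hom G L"
  proof (rule homI)
    fix x assume "x \<in> carrier G"
    then show "h x \<in> carrier L" using wd clL by (simp add: h_def)
  next
    fix x y assume xy: "x \<in> carrier G" "y \<in> carrier G"
    have "h (x \<otimes>\<^bsub>G\<^esub> y) = h (amalg_val G id id (wd x @ wd y))"
      using wd[OF xy(1)] wd[OF xy(2)] by (simp add: amalg_val_append[OF G(1) iA iB])
    also have "\<dots> = amalg_val L f g (wd x @ wd y)"
      using wd[OF xy(1)] wd[OF xy(2)] by (intro hv) auto
    also have "\<dots> = h x \<otimes>\<^bsub>L\<^esub> h y"
      using wd[OF xy(1)] wd[OF xy(2)] by (simp add: amalg_val_append[OF L fA gB] h_def)
    finally show "h (x \<otimes>\<^bsub>G\<^esub> y) = h x \<otimes>\<^bsub>L\<^esub> h y" .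
  qed
  have hA: "h a = f a" if "a \<in> A" for a
    using hv[of "[Inl a]"] that funcset_mem[OF fA that] by (simp add: InlI)
  have hB: "h b = g b" if "b \<in> B" for b
    using hv[of "[Inr b]"] that funcset_mem[OF gB that] by (simp add: InrI)
  have uniq: "h' x = h x" if h': "h' \<in> hom G L" "\<forall>a \<in> A. h' a = f a" "\<forall>b \<in> B. h' b = g b"
    and x: "x \<in> carrier G" for h' x
  proof -
    have "h' (amalg_val G id id w) = amalg_val L f g w" if "w \<in> lists (A <+> B)" for w
      using that
    proof induction
      case Nil
      then show ?case using h'(1) L G(1) by (simp add: hom_one)
    next
      case (Cons l w)
      have l: "case_sum id id l \<in> carrier G" using Cons(1) by auto
      have "h' (case_sum id id l) = case_sum f g l" using Cons(1) h'(2,3) by auto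
      then show ?case using Cons hom_mult[OF h'(1) l clG[OF Cons(2)]]
        by (simp only: amalg_val_simps)
    qed
    from this[of "wd x"] show ?thesis using wd[OF x] by (simp add: h_def)
  qed
  show ?thesis
    by (intro bexI[OF _ hom] conjI ballI impI) (use hA hB uniq in simp_all)
qed

end

theory Submission
  imports Complex_Main Defs "HOL-Algebra.Bij"
begin

text \<open>Let \<open>\<Gamma>\<^sub>H\<close> be the bipartite graph with the double cosets \<open>T x H\<close> as edges and \<open>A x H\<close>, \<open>B x H\<close>
  as vertices, i.e. the quotient by \<open>H\<close> of the Bass--Serre tree of \<open>G\<close>. A finite set of edges of
  \<open>\<Gamma>\<^sub>H\<close> stands for the finite subgraph without isolated vertices that it spans. A labelling of the
  edges of \<open>\<Gamma>\<^sub>H\<close> by elements of a group \<open>L\<close> induces a homomorphism \<open>H \<rightarrow> L\<close>. With \<open>L = \<int>/2\<close> this shows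
  that the reduced rank of \<open>H\<close> is at least \<open>|E| - |V|\<close> for every finite subgraph of \<open>\<Gamma>\<^sub>H\<close>. With \<open>L\<close> a
  group of permutations of reduced words, it shows that the edges outside a spanning tree yield a free
  basis of \<open>H\<close>, so that the reduced rank is, conversely, attained by a finite subgraph.

  Now take such a finite subgraph \<open>D\<close> of \<open>\<Gamma>\<close> for \<open>H \<inter> K\<close> and prune its leaves. Each pair of edges of
  \<open>\<Gamma>\<^sub>H\<close> and \<open>\<Gamma>\<^sub>K\<close> is the image of at most \<open>m\<close> edges of \<open>D\<close>, and the projections to \<open>\<Gamma>\<^sub>H\<close> and \<open>\<Gamma>\<^sub>K\<close> are
  injective around each vertex. Since \<open>2 (|E| - |V|)\<close> is the sum of the excesses \<open>deg v - 2\<close>, comparing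
  degrees on each of the two sides of the bipartition costs a factor \<open>3 m\<close>, which yields the bound
  \<open>6 m\<close>.\<close>

section \<open>Counting in bipartite graphs\<close>

lemma card_image_remove_less:
  assumes "finite D" "e \<in> D" "\<And>e'. e' \<in> D \<Longrightarrow> f e' = f e \<Longrightarrow> e' = e"
  shows "card (f ` (D - {e})) < card (f ` D)"
proof -
  have "f ` D = insert (f e) (f ` (D - {e}))" using assms(2) by blast
  moreover have "f e \<notin> f ` (D - {e})" using assms(3) by (metis DiffE image_iff insertI1)
  ultimately show ?thesis using assms(1) by simp
qed

text \<open>\<open>f\<close> and \<open>g\<close> send an edge to its two endpoints. Deleting an
  edge with an endpoint of degree one also deletes that vertex, so the number of edges minus the
  number of vertices does not drop.\<close>

lemma prune_leaves:
  assumes "finite D" "card (f ` D) + card (g ` D) + n \<le> card D"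
  shows "\<exists>D' \<subseteq> D. card (f ` D') + card (g ` D') + n \<le> card D' \<and>
    (\<forall>e \<in> D'. \<exists>e' \<in> D'. e' \<noteq> e \<and> f e' = f e) \<and> (\<forall>e \<in> D'. \<exists>e' \<in> D'. e' \<noteq> e \<and> g e' = g e)"
  using assms
proof (induction D rule: finite_psubset_induct)
  case (psubset D)
  show ?case
  proof (cases "\<exists>e \<in> D. (\<forall>e' \<in> D. f e' = f e \<longrightarrow> e' = e) \<or> (\<forall>e' \<in> D. g e' = g e \<longrightarrow> e' = e)")
    case True
    then obtain e where e: "e \<in> D"
      "(\<forall>e' \<in> D. f e' = f e \<longrightarrow> e' = e) \<or> (\<forall>e' \<in> D. g e' = g e \<longrightarrow> e' = e)" by blast
    let ?D = "D - {e}"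
    have "card (f ` ?D) + card (g ` ?D) < card (f ` D) + card (g ` D)"
      using e(2)
    proof
      assume 1: "\<forall>e' \<in> D. f e' = f e \<longrightarrow> e' = e"
      have "card (f ` ?D) < card (f ` D)"
        using psubset.hyps e(1) 1 by (intro card_image_remove_less) auto
      moreover have "card (g ` ?D) \<le> card (g ` D)"
        using psubset.hyps by (intro card_mono) auto
      ultimately show ?thesis by simp
    next
      assume 1: "\<forall>e' \<in> D. g e' = g e \<longrightarrow> e' = e"
      have "card (g ` ?D) < card (g ` D)"
        using psubset.hyps e(1) 1 by (intro card_image_remove_less) auto
      moreover have "card (f ` ?D) \<le> card (f ` D)"
        using psubset.hyps by (intro card_mono) auto
      ultimately show ?thesis by simp
    qed
    then have "card (f ` ?D) + card (g ` ?D) + n \<le> card ?D"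
      using psubset.prems e(1) psubset.hyps by simp
    moreover have "?D \<subset> D" using e(1) by blast
    ultimately obtain D' where "D' \<subseteq> ?D" "card (f ` D') + card (g ` D') + n \<le> card D' \<and>
      (\<forall>e \<in> D'. \<exists>e' \<in> D'. e' \<noteq> e \<and> f e' = f e) \<and> (\<forall>e \<in> D'. \<exists>e' \<in> D'. e' \<noteq> e \<and> g e' = g e)"
      using psubset.IH[of ?D] by blast
    then show ?thesis by (intro exI[of _ D'] conjI[of "D' \<subseteq> D"]) blast+
  next
    case False
    then show ?thesis using psubset.prems by (intro exI[of _ D]) auto
  qed
qed

definition deg :: "'e set \<Rightarrow> ('e \<Rightarrow> 'v) \<Rightarrow> 'e \<Rightarrow> nat" where
  "deg D f e = card {e' \<in> D. f e' = f e}"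

lemma deg_ge_2:
  assumes "finite D" "e \<in> D" "e' \<in> D" "e' \<noteq> e" "f e' = f e"
  shows "2 \<le> deg D f e"
proof -
  have "card {e, e'} \<le> deg D f e"
    unfolding deg_def using assms by (intro card_mono) auto
  then show ?thesis using assms by simp
qed

text \<open>The excesses \<open>deg v - 2\<close> of the vertices are spread over their edges as the weights
  \<open>1 - 2 / deg v\<close>, so that graphs can be compared edge by edge.\<close>

lemma sum_deg_weight:
  assumes "finite D"
  shows "(\<Sum>e\<in>D. 1 - 2 / real (deg D f e)) = real (card D) - 2 * real (card (f ` D))"
proof -
  have "(\<Sum>e\<in>D. 1 / real (deg D f e)) = (\<Sum>v\<in>f ` D. \<Sum>e\<in>{e \<in> D. f e = v}. 1 / real (deg D f e))"
    using assms by (rule sum.image_gen)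
  also have "\<dots> = (\<Sum>v\<in>f ` D. 1)"
  proof (rule sum.cong)
    fix v assume "v \<in> f ` D"
    \<comment> \<open>An empty fibre would contribute 0 instead of 1.\<close>
    then have "card {e \<in> D. f e = v} \<noteq> 0" using assms by auto
    then show "(\<Sum>e\<in>{e \<in> D. f e = v}. 1 / real (deg D f e)) = 1" by (simp add: deg_def)
  qed simp
  finally have "(\<Sum>e\<in>D. 1 / real (deg D f e)) = real (card (f ` D))" by simp
  moreover have "(\<Sum>e\<in>D. 2 / real (deg D f e)) = 2 * (\<Sum>e\<in>D. 1 / real (deg D f e))"
    by (simp add: sum_distrib_left)
  ultimately show ?thesis by (simp add: sum_subtractf)
qed

text \<open>By symmetry, let \<open>a \<le> b\<close> be the two larger degrees. If
  \<open>b \<ge> 3\<close>, its weight is at least \<open>1 / 3\<close>, which the factor 3 absorbs;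
  if \<open>b = 2\<close>, all three degrees are 2 and both sides vanish.\<close>

lemma weight_ineq:
  fixes d d1 d2 :: nat
  assumes "2 \<le> d" "d \<le> d1" "d \<le> d2"
  shows "1 - 2 / real d \<le> 3 * ((1 - 2 / real d1) * (1 - 2 / real d2))"
proof -
  have *: "1 - 2 / real d \<le> 3 * ((1 - 2 / real a) * (1 - 2 / real b))"
    if "d \<le> a" "a \<le> b" for a b :: nat
  proof -
    have le: "1 - 2 / real d \<le> 1 - 2 / real a" using assms(1) that by (simp add: frac_le)
    show ?thesis
    proof (cases "b = 2")
      case True
      then show ?thesis using assms that by simp
    next
      case False
      then have "3 \<le> b" using assms that by simp
      then have "1 \<le> 3 * (1 - 2 / real b)" by (simp add: field_simps)
      moreover have "0 \<le> 1 - 2 / real a" using assms(1) that by simp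
      ultimately have "1 - 2 / real a \<le> (1 - 2 / real a) * (3 * (1 - 2 / real b))"
        using mult_left_mono[of 1 "3 * (1 - 2 / real b)" "1 - 2 / real a"] by simp
      then show ?thesis using le by (simp only: mult.left_commute[of 3]) 
    qed
  qed
  show ?thesis using *[of d1 d2] *[of d2 d1] assms by (cases "d1 \<le> d2") (auto simp: mult_ac)
qed

text \<open>This treats one side of the bipartition: \<open>f\<close>, \<open>fp\<close>,
  \<open>fq\<close> send edges to endpoints, \<open>p\<close> and \<open>q\<close> are the
  projections. Since these are injective around each vertex, degrees do not decrease, so
  \<open>weight_ineq\<close> applies edge by edge; grouping edges by their pair of images costs the
  factor \<open>m\<close>, and the sum over all pairs is a product.\<close>

lemma local_count:
  assumes fin: "finite D"
    and fp: "\<And>e e'. e \<in> D \<Longrightarrow> e' \<in> D \<Longrightarrow> f e = f e' \<Longrightarrow> fp (p e) = fp (p e')"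
    and fq: "\<And>e e'. e \<in> D \<Longrightarrow> e' \<in> D \<Longrightarrow> f e = f e' \<Longrightarrow> fq (q e) = fq (q e')"
    and p: "\<And>e e'. e \<in> D \<Longrightarrow> e' \<in> D \<Longrightarrow> f e = f e' \<Longrightarrow> p e = p e' \<Longrightarrow> e = e'"
    and q: "\<And>e e'. e \<in> D \<Longrightarrow> e' \<in> D \<Longrightarrow> f e = f e' \<Longrightarrow> q e = q e' \<Longrightarrow> e = e'"
    and m: "\<And>e. e \<in> D \<Longrightarrow> card {e' \<in> D. p e' = p e \<and> q e' = q e} \<le> m"
    and deg: "\<And>e. e \<in> D \<Longrightarrow> \<exists>e' \<in> D. e' \<noteq> e \<and> f e' = f e"
  shows "2 * card (f ` D) \<le> card D" "2 * card (fp ` p ` D) \<le> card (p ` D)"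
    "2 * card (fq ` q ` D) \<le> card (q ` D)"
    "real (card D) - 2 * real (card (f ` D)) \<le> 3 * real m *
       ((real (card (p ` D)) - 2 * real (card (fp ` p ` D))) *
        (real (card (q ` D)) - 2 * real (card (fq ` q ` D))))"
proof -
  have d: "2 \<le> deg D f e" if "e \<in> D" for e
    using deg[OF that] deg_ge_2[OF fin that] by blast
  have dp: "deg D f e \<le> deg (p ` D) fp (p e)" if "e \<in> D" for e
    unfolding deg_def
  proof (rule card_inj_on_le[of p])
    show "inj_on p {e' \<in> D. f e' = f e}" using p by (auto intro: inj_onI)
    show "p ` {e' \<in> D. f e' = f e} \<subseteq> {e' \<in> p ` D. fp e' = fp (p e)}" using fp that by blast
  qed (use fin in simp)
  have dq: "deg D f e \<le> deg (q ` D) fq (q e)" if "e \<in> D" for e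
    unfolding deg_def
  proof (rule card_inj_on_le[of q])
    show "inj_on q {e' \<in> D. f e' = f e}" using q by (auto intro: inj_onI)
    show "q ` {e' \<in> D. f e' = f e} \<subseteq> {e' \<in> q ` D. fq e' = fq (q e)}" using fq that by blast
  qed (use fin in simp)
  define u where "u e = 1 - 2 / real (deg (p ` D) fp e)" for e
  define v where "v e = 1 - 2 / real (deg (q ` D) fq e)" for e
  have nn: "0 \<le> 1 - 2 / real n" if "2 \<le> n" for n :: nat using that by simp
  have u: "0 \<le> u e" if "e \<in> p ` D" for e
    using that order_trans[OF d dp] nn unfolding u_def by blast
  have v: "0 \<le> v e" if "e \<in> q ` D" for e
    using that order_trans[OF d dq] nn unfolding v_def by blast
  have su: "sum u (p ` D) = real (card (p ` D)) - 2 * real (card (fp ` p ` D))"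
    unfolding u_def using fin by (intro sum_deg_weight) simp
  have sv: "sum v (q ` D) = real (card (q ` D)) - 2 * real (card (fq ` q ` D))"
    unfolding v_def using fin by (intro sum_deg_weight) simp
  have sd: "(\<Sum>e\<in>D. 1 - 2 / real (deg D f e)) = real (card D) - 2 * real (card (f ` D))"
    using fin by (rule sum_deg_weight)
  have "0 \<le> (\<Sum>e\<in>D. 1 - 2 / real (deg D f e))"
    using d nn by (intro sum_nonneg) blast
  then show "2 * card (f ` D) \<le> card D" unfolding sd by linarith
  have "0 \<le> sum u (p ` D)" using u by (rule sum_nonneg)
  then show "2 * card (fp ` p ` D) \<le> card (p ` D)" unfolding su by linarith
  have "0 \<le> sum v (q ` D)" using v by (rule sum_nonneg)
  then show "2 * card (fq ` q ` D) \<le> card (q ` D)" unfolding sv by linarith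
  define w where "w z = u (fst z) * v (snd z)" for z
  let ?Z = "(\<lambda>e. (p e, q e)) ` D"
  have "(\<Sum>e\<in>D. 1 - 2 / real (deg D f e)) \<le> (\<Sum>e\<in>D. 3 * w (p e, q e))"
    unfolding w_def u_def v_def using weight_ineq[OF d dp dq] by (intro sum_mono) simp
  also have "\<dots> = 3 * (\<Sum>z\<in>?Z. \<Sum>e\<in>{e \<in> D. (p e, q e) = z}. w (p e, q e))"
    using fin by (simp add: sum_distrib_left[symmetric] sum.image_gen[of D "\<lambda>e. w (p e, q e)" "\<lambda>e. (p e, q e)"])
  also have "(\<Sum>z\<in>?Z. \<Sum>e\<in>{e \<in> D. (p e, q e) = z}. w (p e, q e)) \<le> (\<Sum>z\<in>?Z. real m * w z)"
  proof (rule sum_mono)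
    fix z assume "z \<in> ?Z"
    then obtain e where e: "e \<in> D" "z = (p e, q e)" by blast
    have "(\<Sum>e\<in>{e \<in> D. (p e, q e) = z}. w (p e, q e)) = real (card {e' \<in> D. p e' = p e \<and> q e' = q e}) * w z"
      using e by simp
    also have "\<dots> \<le> real m * w z"
      using m[OF e(1)] e u v by (intro mult_right_mono) (auto simp: w_def)
    finally show "(\<Sum>e\<in>{e \<in> D. (p e, q e) = z}. w (p e, q e)) \<le> real m * w z" .
  qed
  \<comment> \<open>The weights are nonnegative because all degrees are at least 2, so pairs outside
    the image of \<open>D\<close> may be added.\<close>
  also have "(\<Sum>z\<in>?Z. real m * w z) \<le> (\<Sum>z\<in>p ` D \<times> q ` D. real m * w z)"
    using fin u v by (intro sum_mono2) (auto simp: w_def)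
  also have "\<dots> = real m * sum w (p ` D \<times> q ` D)" by (simp only: sum_distrib_left)
  also have "sum w (p ` D \<times> q ` D) = sum u (p ` D) * sum v (q ` D)"
    unfolding w_def sum_product sum.cartesian_product by (simp add: case_prod_unfold)
  finally show "real (card D) - 2 * real (card (f ` D)) \<le> 3 * real m *
       ((real (card (p ` D)) - 2 * real (card (fp ` p ` D))) *
        (real (card (q ` D)) - 2 * real (card (fq ` q ` D))))"
    unfolding sd su sv by simp
qed

section \<open>Double cosets\<close>

definition dcos :: "('a, 'b) monoid_scheme \<Rightarrow> 'a set \<Rightarrow> 'a set \<Rightarrow> 'a \<Rightarrow> 'a set" where
  "dcos G P H x = {p \<otimes>\<^bsub>G\<^esub> x \<otimes>\<^bsub>G\<^esub> h | p h. p \<in> P \<and> h \<in> H}"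

context group
begin

lemma dcosI: "p \<in> P \<Longrightarrow> h \<in> H \<Longrightarrow> p \<otimes> x \<otimes> h \<in> dcos G P H x"
  by (auto simp: dcos_def)

lemma dcos_self:
  assumes "subgroup P G" "subgroup H G" "x \<in> carrier G"
  shows "x \<in> dcos G P H x"
  using dcosI[OF subgroup.one_closed[OF assms(1)] subgroup.one_closed[OF assms(2)], of x] assms(3)
  by simp

lemma dcos_closed:
  assumes "subgroup P G" "subgroup H G" "x \<in> carrier G"
  shows "dcos G P H x \<subseteq> carrier G"
  using assms subgroup.mem_carrier by (fastforce simp: dcos_def)

lemma dcos_mult:
  assumes P: "subgroup P G" and H: "subgroup H G" and x: "x \<in> carrier G" and p: "p \<in> P" and h: "h \<in> H"
  shows "dcos G P H (p \<otimes> x \<otimes> h) = dcos G P H x"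
proof -
  note c = subgroup.mem_carrier[OF P] subgroup.mem_carrier[OF H]
  have *: "dcos G P H (p \<otimes> y \<otimes> h) \<subseteq> dcos G P H y"
    if "y \<in> carrier G" "p \<in> P" "h \<in> H" for y p h
  proof
    fix z assume "z \<in> dcos G P H (p \<otimes> y \<otimes> h)"
    then obtain p' h' where z: "p' \<in> P" "h' \<in> H" "z = p' \<otimes> (p \<otimes> y \<otimes> h) \<otimes> h'"
      by (auto simp: dcos_def)
    then have "z = (p' \<otimes> p) \<otimes> y \<otimes> (h \<otimes> h')" using that c by (simp add: m_assoc)
    then show "z \<in> dcos G P H y"
      using z that dcosI subgroup.m_closed[OF P] subgroup.m_closed[OF H] by metis
  qed
  have "x = inv p \<otimes> (p \<otimes> x \<otimes> h) \<otimes> inv h"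
    using x c p h by (simp add: m_assoc[symmetric]) (simp add: m_assoc)
  then have "dcos G P H x \<subseteq> dcos G P H (p \<otimes> x \<otimes> h)"
    using *[of "p \<otimes> x \<otimes> h" "inv p" "inv h"] x c p h
      subgroup.m_inv_closed[OF P] subgroup.m_inv_closed[OF H] by simp
  then show ?thesis using *[OF x p h] by blast
qed

lemma dcos_eqD:
  assumes "subgroup P G" "subgroup H G" "y \<in> carrier G" "dcos G P H x = dcos G P H y"
  obtains p h where "p \<in> P" "h \<in> H" "y = p \<otimes> x \<otimes> h"
  using dcos_self[OF assms(1-3)] unfolding assms(4)[symmetric] by (auto simp: dcos_def)

text \<open>Identifies the endpoint map: multiplying an edge by a factor on the left yields its
  vertex on that side, without a choice of representatives.\<close>

lemma set_mult_dcos: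
  assumes P: "subgroup P G" and T: "subgroup T G" and H: "subgroup H G" and TP: "T \<subseteq> P"
    and x: "x \<in> carrier G"
  shows "P <#> dcos G T H x = dcos G P H x"
proof -
  note c = subgroup.mem_carrier[OF P] subgroup.mem_carrier[OF T] subgroup.mem_carrier[OF H]
  show ?thesis
  proof
    show "P <#> dcos G T H x \<subseteq> dcos G P H x"
    proof
      fix z assume "z \<in> P <#> dcos G T H x"
      then obtain p t h where z: "p \<in> P" "t \<in> T" "h \<in> H" "z = p \<otimes> (t \<otimes> x \<otimes> h)"
        by (auto simp: set_mult_def dcos_def)
      then have "z = (p \<otimes> t) \<otimes> x \<otimes> h" using c x by (simp add: m_assoc)
      then show "z \<in> dcos G P H x" using z TP dcosI subgroup.m_closed[OF P] by (metis subsetD)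
    qed
    show "dcos G P H x \<subseteq> P <#> dcos G T H x"
    proof
      fix z assume "z \<in> dcos G P H x"
      then obtain p h where z: "p \<in> P" "h \<in> H" "z = p \<otimes> x \<otimes> h" by (auto simp: dcos_def)
      then have "z = p \<otimes> (\<one> \<otimes> x \<otimes> h)" using c x by (simp add: m_assoc)
      then show "z \<in> P <#> dcos G T H x"
        using z dcosI[OF subgroup.one_closed[OF T] z(2)] by (auto simp: set_mult_def)
    qed
  qed
qed

text \<open>Identifies the projection of quotient graphs: multiplying an edge for \<open>L\<close>
  by \<open>H\<close> on the right yields the edge for \<open>H\<close> below it.\<close>

lemma dcos_set_mult:
  assumes T: "subgroup T G" and L: "subgroup L G" and H: "subgroup H G" and LH: "L \<subseteq> H"
    and x: "x \<in> carrier G"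
  shows "dcos G T L x <#> H = dcos G T H x"
proof -
  note c = subgroup.mem_carrier[OF L] subgroup.mem_carrier[OF T] subgroup.mem_carrier[OF H]
  show ?thesis
  proof
    show "dcos G T L x <#> H \<subseteq> dcos G T H x"
    proof
      fix z assume "z \<in> dcos G T L x <#> H"
      then obtain t l h where z: "t \<in> T" "l \<in> L" "h \<in> H" "z = t \<otimes> x \<otimes> l \<otimes> h"
        by (auto simp: set_mult_def dcos_def)
      then have "z = t \<otimes> x \<otimes> (l \<otimes> h)" using c x by (simp add: m_assoc)
      then show "z \<in> dcos G T H x" using z LH dcosI subgroup.m_closed[OF H] by (metis subsetD)
    qed
    show "dcos G T H x \<subseteq> dcos G T L x <#> H"
    proof
      fix z assume "z \<in> dcos G T H x"
      then obtain t h where z: "t \<in> T" "h \<in> H" "z = t \<otimes> x \<otimes> h" by (auto simp: dcos_def)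
      then have "z = t \<otimes> x \<otimes> \<one> \<otimes> h" using c x by (simp add: m_assoc)
      then show "z \<in> dcos G T L x <#> H"
        using z dcosI[OF z(1) subgroup.one_closed[OF L]] by (auto simp: set_mult_def)
    qed
  qed
qed

end

section \<open>Edge labellings of the quotient graph\<close>

locale amalgam = group G for G (structure) +
  fixes A B T :: "'a set"
  assumes amalgamated: "amalgamated_free_product G A B T"
begin

lemma subgroups: "subgroup A G" "subgroup B G" "subgroup T G" and T_subset: "T \<subseteq> A" "T \<subseteq> B"
  using amalgamated by (auto simp: amalgamated_free_product_def)

lemmas A_carrier = subgroup.mem_carrier[OF subgroups(1)]
lemmas B_carrier = subgroup.mem_carrier[OF subgroups(2)]
lemmas T_carrier = subgroup.mem_carrier[OF subgroups(3)]

definition val :: "('a + 'a) list \<Rightarrow> 'a" where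
  "val = amalg_val G id id"

lemma val_simps [simp]:
  "val [] = \<one>" "val (Inl x # w) = x \<otimes> val w" "val (Inr x # w) = x \<otimes> val w"
  by (simp_all only: val_def amalg_val_simps sum.case id_apply)

lemma val_closed: "w \<in> lists (A <+> B) \<Longrightarrow> val w \<in> carrier G"
  unfolding val_def using A_carrier B_carrier by (intro amalg_val_closed) (auto intro: is_group)

lemma val_append:
  "u \<in> lists (A <+> B) \<Longrightarrow> v \<in> lists (A <+> B) \<Longrightarrow> val (u @ v) = val u \<otimes> val v"
  unfolding val_def using A_carrier B_carrier by (intro amalg_val_append) (auto intro: is_group)

lemma val_surj: "val ` lists (A <+> B) = carrier G"
  using amalgamated unfolding val_def amalgamated_free_product_def by blast

lemma val_eq_iff:
  "u \<in> lists (A <+> B) \<Longrightarrow> v \<in> lists (A <+> B) \<Longrightarrow>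
    val u = val v \<longleftrightarrow> equivclp (amalg_step G A B T) u v"
  using amalgamated unfolding val_def amalgamated_free_product_def by blast

lemma amalgam_induct [consumes 1, case_names one left right]:
  assumes "x \<in> carrier G" "Q \<one>"
    and "\<And>a x. a \<in> A \<Longrightarrow> x \<in> carrier G \<Longrightarrow> Q x \<Longrightarrow> Q (a \<otimes> x)"
    and "\<And>b x. b \<in> B \<Longrightarrow> x \<in> carrier G \<Longrightarrow> Q x \<Longrightarrow> Q (b \<otimes> x)"
  shows "Q x"
proof -
  have "Q (val w)" if "w \<in> lists (A <+> B)" for w
    using that
  proof induction
    case (Cons l w)
    then show ?case using assms(3,4) val_closed[OF Cons(2)] by (cases l) auto
  qed (simp add: assms(2))
  moreover obtain w where "w \<in> lists (A <+> B)" "x = val w"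
    using assms(1) unfolding val_surj[symmetric] by (rule imageE)
  ultimately show ?thesis by blast
qed

text \<open>\<open>F\<close> is a potential on the Bass--Serre tree for the labels \<open>l\<close> of its edges. It exists because \<open>G\<close>
  has no relations besides those of the amalgam.\<close>

lemma potential:
  assumes L: "group L" and l: "\<And>x. x \<in> carrier G \<Longrightarrow> l x \<in> carrier L"
    and lT: "\<And>t x. t \<in> T \<Longrightarrow> x \<in> carrier G \<Longrightarrow> l (t \<otimes> x) = l x"
  obtains F where "F \<in> carrier G \<rightarrow> carrier L" "F \<one> = \<one>\<^bsub>L\<^esub>"
    "\<And>a x. a \<in> A \<Longrightarrow> x \<in> carrier G \<Longrightarrow> F (a \<otimes> x) = F x"
    "\<And>b x. b \<in> B \<Longrightarrow> x \<in> carrier G \<Longrightarrow> l (b \<otimes> x) \<otimes>\<^bsub>L\<^esub> F (b \<otimes> x) = l x \<otimes>\<^bsub>L\<^esub> F x"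
proof -
  interpret L: group L by fact
  let ?W = "lists (A <+> B)"
  \<comment> \<open>\<open>F x\<close> is meant as the potential of the vertex of \<open>x\<close>
    on the side of \<open>A\<close>, and \<open>l x \<otimes> F x\<close> as that on the side of
    \<open>B\<close>. So a letter of \<open>A\<close> leaves \<open>F\<close> unchanged, and a
    letter of \<open>B\<close> changes it so as to keep \<open>l x \<otimes> F x\<close>
    fixed.\<close>
  define step :: "'a + 'a \<Rightarrow> 'a \<Rightarrow> 'c" where "step k x = (case k of Inl a \<Rightarrow> \<one>\<^bsub>L\<^esub> | Inr b \<Rightarrow> inv\<^bsub>L\<^esub> l (b \<otimes> x) \<otimes>\<^bsub>L\<^esub> l x)"
    for k x
  define Fw where "Fw = rec_list \<one>\<^bsub>L\<^esub> (\<lambda>k w r. step k (val w) \<otimes>\<^bsub>L\<^esub> r)"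
  have Fw: "Fw [] = \<one>\<^bsub>L\<^esub>" "Fw (k # w) = step k (val w) \<otimes>\<^bsub>L\<^esub> Fw w" for k w
    by (simp_all add: Fw_def)
  have step_cl: "step k x \<in> carrier L" if "k \<in> A <+> B" "x \<in> carrier G" for k x
    using that l B_carrier by (auto simp: step_def)
  have cl: "Fw w \<in> carrier L" if "w \<in> ?W" for w
    using that by induction (use step_cl val_closed in \<open>auto simp: Fw\<close>)
  have inv: "(u \<in> ?W \<longleftrightarrow> v \<in> ?W) \<and> (u \<in> ?W \<longrightarrow> val u = val v \<and> Fw u = Fw v)"
    if st: "amalg_step G A B T u v" for u v
  proof -
    have "u \<in> ?W \<longleftrightarrow> v \<in> ?W"
      by (rule amalg_step_val(1)[OF is_group is_group subgroups(1,2) T_subset _ _ _ that, of id id])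
        (use A_carrier B_carrier in \<open>auto simp: hom_def\<close>)
    moreover have "val u = val v" if "u \<in> ?W"
      unfolding val_def
      by (rule amalg_step_val(2)[OF is_group is_group subgroups(1,2) T_subset _ _ _ st that])
        (use A_carrier B_carrier in \<open>auto simp: hom_def\<close>)
    ultimately have v: "u \<in> ?W \<longleftrightarrow> v \<in> ?W" "u \<in> ?W \<Longrightarrow> val u = val v" by blast+
    \<comment> \<open>The letters of a common prefix contribute equal factors, since these depend
      only on the values of the suffixes, which agree.\<close>
    have pre: "Fw (w @ u) = Fw (w @ v)" if "w @ u \<in> ?W" "w @ v \<in> ?W" "Fw u = Fw v" "val u = val v" for w u v
      using that
    proof (induction w)
      case (Cons k w)
      then have "val (w @ u) = val (w @ v)" by (simp add: val_append)
      then show ?case using Cons by (simp add: Fw)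
    qed simp
    have "Fw u = Fw v" if W: "u \<in> ?W"
      using st
    proof cases
      case (mult_left x y w z)
      then have xy: "x \<in> carrier G" "y \<in> carrier G" and z: "z \<in> ?W" using W A_carrier by auto
      show ?thesis unfolding mult_left
        by (rule pre) (use W v mult_left xy z val_closed[OF z] cl[OF z] in \<open>auto simp: Fw step_def m_assoc\<close>)
    next
      case (mult_right x y w z)
      then have xy: "x \<in> carrier G" "y \<in> carrier G" and z: "z \<in> ?W" using W B_carrier by auto
      \<comment> \<open>The labels at \<open>y \<otimes> val z\<close> cancel between the two
        factors.\<close>
      have "step (Inr x) (y \<otimes> val z) \<otimes>\<^bsub>L\<^esub> (step (Inr y) (val z) \<otimes>\<^bsub>L\<^esub> Fw z) = step (Inr (x \<otimes> y)) (val z) \<otimes>\<^bsub>L\<^esub> Fw z"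
        using xy val_closed[OF z] cl[OF z] l
        by (simp add: step_def m_assoc L.m_assoc) (simp add: L.m_assoc[symmetric])
      then show ?thesis unfolding mult_right
        by (intro pre) (use W v mult_right xy z val_closed[OF z] cl[OF z] in \<open>auto simp: Fw m_assoc\<close>)
    next
      case (one_left w z)
      then have z: "z \<in> ?W" using W by auto
      show ?thesis unfolding one_left
        by (rule pre[of _ "[Inl \<one>] @ z" z]) (use W v one_left z val_closed[OF z] cl[OF z] in \<open>auto simp: Fw step_def\<close>)
    next
      case (one_right w z)
      then have z: "z \<in> ?W" using W by auto
      show ?thesis unfolding one_right
        by (rule pre[of _ "[Inr \<one>] @ z" z])
          (use W v one_right z val_closed[OF z] cl[OF z] l in \<open>auto simp: Fw step_def\<close>)
    next
      case (identify t w z)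
      then have z: "z \<in> ?W" using W by auto
      \<comment> \<open>Both copies of \<open>t\<close> contribute a trivial factor, the right one
        thanks to \<open>lT\<close>.\<close>
      show ?thesis unfolding identify
        by (rule pre) (use W v identify z val_closed[OF z] cl[OF z] l lT in \<open>auto simp: Fw step_def\<close>)
    qed
    then show ?thesis using v by blast
  qed
  have eqv: "Fw u = Fw v" if "u \<in> ?W" "v \<in> ?W" "val u = val v" for u v
  proof -
    have "equivclp (amalg_step G A B T) u v"
      using that val_eq_iff by blast
    then have "v \<in> ?W \<and> Fw u = Fw v"
    proof (induction rule: equivclp_induct)
      case (step y z)
      then show ?case using inv by metis
    qed (use that in auto)
    then show ?thesis by blast
  qed
  have "\<forall>x \<in> carrier G. \<exists>w. w \<in> ?W \<and> val w = x"
    unfolding val_surj[symmetric] by (intro ballI) (elim imageE, blast)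
  then obtain wd where wd: "\<And>x. x \<in> carrier G \<Longrightarrow> wd x \<in> ?W \<and> val (wd x) = x" by metis
  define F where "F x = Fw (wd x)" for x
  have F: "F (val w) = Fw w" if "w \<in> ?W" for w
    unfolding F_def using eqv wd val_closed that by metis
  show ?thesis
  proof (rule that)
    show "F \<in> carrier G \<rightarrow> carrier L" using wd cl by (auto simp: F_def)
    show "F \<one> = \<one>\<^bsub>L\<^esub>" using F[of "[]"] by (simp add: Fw)
    show "F (a \<otimes> x) = F x" if "a \<in> A" "x \<in> carrier G" for a x
    proof -
      have "Inl a # wd x \<in> ?W" using wd that by auto
      from F[OF this] show ?thesis using wd[OF that(2)] cl by (simp add: Fw step_def F_def)
    qed
    show "l (b \<otimes> x) \<otimes>\<^bsub>L\<^esub> F (b \<otimes> x) = l x \<otimes>\<^bsub>L\<^esub> F x" if "b \<in> B" "x \<in> carrier G" for b x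
    proof -
      have "Inr b # wd x \<in> ?W" using wd that by auto
      from F[OF this] have "F (b \<otimes> x) = inv\<^bsub>L\<^esub> l (b \<otimes> x) \<otimes>\<^bsub>L\<^esub> l x \<otimes>\<^bsub>L\<^esub> F x"
        using wd[OF that(2)] by (simp add: Fw step_def F_def)
      then show ?thesis using that B_carrier l cl wd
        by (simp add: L.m_assoc[symmetric] F_def)
    qed
  qed
qed

end

section \<open>Homomorphisms on words, and edge labels modulo two\<close>

lemma word_val_simps [simp]:
  "word_val F [] = \<one>\<^bsub>F\<^esub>" "word_val F (l # w) = letter_val F l \<otimes>\<^bsub>F\<^esub> word_val F w"
  by (simp_all add: word_val_def)

context group_hom
begin

lemma letter_val_closed:
  "l \<in> carrier G \<times> UNIV \<Longrightarrow> letter_val G l \<in> carrier G"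
  by (auto simp: letter_val_def)

lemma word_val_closed:
  "w \<in> lists (carrier G \<times> UNIV) \<Longrightarrow> word_val G w \<in> carrier G"
  by (induction w) (use letter_val_closed in auto)

lemma hom_word_val:
  assumes "w \<in> lists (carrier G \<times> UNIV)"
  shows "h (word_val G w) = word_val H (map (apfst h) w)"
  using assms
proof induction
  case (Cons l w)
  then show ?case using letter_val_closed[of l] word_val_closed[of w]
    by (auto simp: letter_val_def)
qed simp

end

text \<open>On truth values, \<open>\<noteq>\<close> is addition modulo 2, so a labelling by this
  group is just a set of edges.\<close>

definition Z2 :: "bool monoid" where
  "Z2 = \<lparr>carrier = UNIV, mult = (\<noteq>), one = False\<rparr>"

lemma group_Z2: "group Z2"
  by (rule groupI) (auto simp: Z2_def)

lemma Z2_simps [simp]: "carrier Z2 = UNIV" "x \<otimes>\<^bsub>Z2\<^esub> y \<longleftrightarrow> x \<noteq> y" "\<one>\<^bsub>Z2\<^esub> = False"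
  by (auto simp: Z2_def)

context amalgam
begin

text \<open>Truth values index the factors so that \<open>\<not> i\<close> is the opposite side of
  the bipartition.\<close>

definition P :: "bool \<Rightarrow> 'a set" where
  "P i = (if i then A else B)"

lemma P_simps [simp]: "P True = A" "P False = B"
  by (simp_all add: P_def)

lemma P: "subgroup (P i) G" and T_subset_P: "T \<subseteq> P i"
  using subgroups T_subset by (simp_all add: P_def)

lemma P_carrier: "p \<in> P i \<Longrightarrow> p \<in> carrier G"
  using subgroup.mem_carrier[OF P] .

text \<open>Labels attached to edges of the quotient graph are invariant under right multiplication
  by \<open>H\<close>. The potential then satisfies
  \<open>F (x \<otimes> h) = F x \<otimes> F h\<close>, because both sides obey the same rules under
  left multiplication of \<open>x\<close>; hence \<open>F\<close> restricts to a homomorphism on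
  \<open>H\<close>.\<close>

lemma edge_potential:
  assumes H: "subgroup H G" and L: "group L" and l: "\<And>e. l e \<in> carrier L"
  obtains \<Phi> \<phi> where "\<phi> \<in> hom (G\<lparr>carrier := H\<rparr>) L"
    "\<And>i x. x \<in> carrier G \<Longrightarrow> \<Phi> i x \<in> carrier L"
    "\<And>i p x h. p \<in> P i \<Longrightarrow> x \<in> carrier G \<Longrightarrow> h \<in> H \<Longrightarrow> \<Phi> i (p \<otimes> x \<otimes> h) = \<Phi> i x \<otimes>\<^bsub>L\<^esub> \<phi> h"
    "\<And>x. x \<in> carrier G \<Longrightarrow> \<Phi> False x = l (dcos G T H x) \<otimes>\<^bsub>L\<^esub> \<Phi> True x"
    "\<Phi> True \<one> = \<one>\<^bsub>L\<^esub>"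
proof -
  interpret L: group L by fact
  interpret H: subgroup H G by fact
  let ?l = "\<lambda>x. l (dcos G T H x)"
  have lT: "?l (t \<otimes> x) = ?l x" if "t \<in> T" "x \<in> carrier G" for t x
    using dcos_mult[OF subgroups(3) H that(2,1) H.one_closed] that T_carrier by simp
  have lH: "?l (x \<otimes> h) = ?l x" if "h \<in> H" "x \<in> carrier G" for h x
    using dcos_mult[OF subgroups(3) H that(2) subgroup.one_closed[OF subgroups(3)] that(1)] that by simp
  obtain F where F: "F \<in> carrier G \<rightarrow> carrier L" "F \<one> = \<one>\<^bsub>L\<^esub>"
    "\<And>a x. a \<in> A \<Longrightarrow> x \<in> carrier G \<Longrightarrow> F (a \<otimes> x) = F x"
    "\<And>b x. b \<in> B \<Longrightarrow> x \<in> carrier G \<Longrightarrow> ?l (b \<otimes> x) \<otimes>\<^bsub>L\<^esub> F (b \<otimes> x) = ?l x \<otimes>\<^bsub>L\<^esub> F x"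
    using potential[of L ?l] L l lT by metis
  note Fc = funcset_mem[OF F(1)]
  have FH: "F (x \<otimes> h) = F x \<otimes>\<^bsub>L\<^esub> F h" if "x \<in> carrier G" "h \<in> H" for x h
    using that(1)
  proof (induction rule: amalgam_induct)
    case one
    then show ?case using that Fc F(2) by simp
  next
    case (left a x)
    then show ?case using that F(3) A_carrier by (simp add: m_assoc)
  next
    case (right b x)
    have c: "b \<in> carrier G" "h \<in> carrier G" using right that B_carrier by auto
    have "?l (b \<otimes> x) \<otimes>\<^bsub>L\<^esub> F (b \<otimes> x \<otimes> h) = ?l (b \<otimes> (x \<otimes> h)) \<otimes>\<^bsub>L\<^esub> F (b \<otimes> (x \<otimes> h))"
      using c right lH[OF that(2), of "b \<otimes> x"] by (simp add: m_assoc)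
    also have "\<dots> = ?l x \<otimes>\<^bsub>L\<^esub> F x \<otimes>\<^bsub>L\<^esub> F h"
      using F(4)[OF right(1), of "x \<otimes> h"] right c lH[OF that(2), of x] l Fc by (simp add: L.m_assoc)
    also have "\<dots> = ?l (b \<otimes> x) \<otimes>\<^bsub>L\<^esub> (F (b \<otimes> x) \<otimes>\<^bsub>L\<^esub> F h)"
      using F(4)[OF right(1,2)] right c l Fc by (simp add: L.m_assoc[symmetric])
    finally show ?case using l Fc right c by simp
  qed
  \<comment> \<open>The potentials at the two endpoints of the edge of \<open>x\<close>.\<close>
  define \<Phi> where "\<Phi> i x = (if i then F x else ?l x \<otimes>\<^bsub>L\<^esub> F x)" for i x
  show ?thesis
  proof (rule that)
    show "F \<in> hom (G\<lparr>carrier := H\<rparr>) L"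
      using Fc FH by (auto simp: hom_def)
    show "\<Phi> i x \<in> carrier L" if "x \<in> carrier G" for i x
      using that Fc l by (simp add: \<Phi>_def)
    show "\<Phi> i (p \<otimes> x \<otimes> h) = \<Phi> i x \<otimes>\<^bsub>L\<^esub> F h" if "p \<in> P i" "x \<in> carrier G" "h \<in> H" for i p x h
    proof -
      have c: "p \<in> carrier G" "h \<in> carrier G" using that P_carrier by auto
      show ?thesis
      proof (cases i)
        case True
        then show ?thesis using FH[OF _ that(3), of "p \<otimes> x"] F(3) that c by (simp add: \<Phi>_def)
      next
        case False
        then show ?thesis using FH[OF _ that(3), of "p \<otimes> x"] F(4) that c lH[OF that(3), of "p \<otimes> x"] l Fc
          by (simp add: \<Phi>_def L.m_assoc[symmetric])
      qed
    qed
    show "\<Phi> False x = ?l x \<otimes>\<^bsub>L\<^esub> \<Phi> True x" if "x \<in> carrier G" for x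
      by (simp add: \<Phi>_def)
    show "\<Phi> True \<one> = \<one>\<^bsub>L\<^esub>" using F(2) by (simp add: \<Phi>_def)
  qed
qed

text \<open>Each labelling of the edges in \<open>C\<close> by elements of \<open>\<int>/2\<close> induces a homomorphism
  \<open>H \<rightarrow> \<int>/2\<close>, which is determined by its values on \<open>Y\<close>. Two labellings with the same homomorphism
  differ by a coboundary, i.e. by a set of vertices up to complementation.\<close>

lemma rank_lower_bound:
  assumes H: "subgroup H G" and Y: "free_basis (G\<lparr>carrier := H\<rparr>) Y" "finite Y"
    and C: "finite C" "C \<noteq> {}" "C \<subseteq> dcos G T H ` carrier G"
  shows "card C + 1 \<le> card Y + card ((<#>) A ` C) + card ((<#>) B ` C)"
proof -
  interpret H: subgroup H G by fact
  let ?H = "G\<lparr>carrier := H\<rparr>"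
  define good where "good S \<Phi> \<phi> \<longleftrightarrow> \<phi> \<in> hom ?H Z2 \<and>
    (\<forall>i x p h. p \<in> P i \<longrightarrow> x \<in> carrier G \<longrightarrow> h \<in> H \<longrightarrow> \<Phi> i (p \<otimes> x \<otimes> h) = (\<Phi> i x \<noteq> \<phi> h)) \<and>
    (\<forall>x. x \<in> carrier G \<longrightarrow> \<Phi> False x = ((dcos G T H x \<in> S) \<noteq> \<Phi> True x))"
    for S and \<Phi> :: "bool \<Rightarrow> 'a \<Rightarrow> bool" and \<phi>
  have "\<exists>\<Phi> \<phi>. good S \<Phi> \<phi>" for S
  proof -
    obtain \<Phi> \<phi> where "\<phi> \<in> hom ?H Z2"
      "\<And>i p x h. p \<in> P i \<Longrightarrow> x \<in> carrier G \<Longrightarrow> h \<in> H \<Longrightarrow> \<Phi> i (p \<otimes> x \<otimes> h) = \<Phi> i x \<otimes>\<^bsub>Z2\<^esub> \<phi> h"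
      "\<And>x. x \<in> carrier G \<Longrightarrow> \<Phi> False x = (dcos G T H x \<in> S) \<otimes>\<^bsub>Z2\<^esub> \<Phi> True x"
      by (rule edge_potential[OF H group_Z2, of "\<lambda>e. e \<in> S"]) (auto simp del: Z2_simps(2,3))
    then show ?thesis unfolding good_def by (intro exI[of _ \<Phi>] exI[of _ \<phi>]) simp
  qed
  then obtain \<Phi> \<phi> where good: "\<And>S. good S (\<Phi> S) (\<phi> S)" by metis
  have \<phi>: "\<phi> S \<in> hom ?H Z2"
    and \<Phi>: "p \<in> P i \<Longrightarrow> x \<in> carrier G \<Longrightarrow> h \<in> H \<Longrightarrow> \<Phi> S i (p \<otimes> x \<otimes> h) = (\<Phi> S i x \<noteq> \<phi> S h)"
    and \<Phi>S: "x \<in> carrier G \<Longrightarrow> \<Phi> S False x = ((dcos G T H x \<in> S) \<noteq> \<Phi> S True x)" for S i p x h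
    using good[of S] by (simp_all add: good_def)
  have gen: "\<phi> S h = \<phi> S' h" if eq: "\<And>y. y \<in> Y \<Longrightarrow> \<phi> S y = \<phi> S' y" and h: "h \<in> H" for S S' h
  proof -
    have gH: "group ?H" and Y': "Y \<subseteq> H" using Y by (auto simp: free_basis_def)
    have "h \<in> word_val ?H ` reduced_words Y" using Y h by (simp add: free_basis_def bij_betw_def)
    then obtain w where w: "w \<in> lists (Y \<times> UNIV)" "h = word_val ?H w"
      by (auto simp: reduced_words_def)
    have wv: "\<phi> R h = word_val Z2 (map (apfst (\<phi> R)) w)" for R
      unfolding w(2) by (rule group_hom.hom_word_val)
        (use gH group_Z2 \<phi> w(1) Y' in \<open>auto simp: group_hom_def group_hom_axioms_def\<close>)
    have "map (apfst (\<phi> S)) w = map (apfst (\<phi> S')) w"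
      using w(1) eq by (auto intro!: map_cong prod_eqI)
    then show ?thesis by (simp only: wv)
  qed
  define V where "V = {True} \<times> (<#>) A ` C \<union> {False} \<times> (<#>) B ` C"
  define \<delta> where "\<delta> W = {e \<in> C. ((True, A <#> e) \<in> W) \<noteq> ((False, B <#> e) \<in> W)}" for W :: "(bool \<times> 'a set) set"
  define \<Psi> where "\<Psi> S = {y \<in> Y. \<phi> S y}" for S
  obtain e0 where e0: "e0 \<in> C" using C by blast
  \<comment> \<open>A set of vertices and its complement have the same coboundary, so the sets
    avoiding \<open>v0\<close> suffice. This saves one vertex and yields the summand 1 of the
    claim.\<close>
  define v0 where "v0 = (True, A <#> e0)"
  have v0: "v0 \<in> V" using e0 by (simp add: V_def v0_def)
  have finV: "finite V" using C by (simp add: V_def)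
  have compl: "\<delta> (V - W) = \<delta> W" for W
  proof -
    have "(True, A <#> e) \<in> V" "(False, B <#> e) \<in> V" if "e \<in> C" for e using that by (auto simp: V_def)
    then show ?thesis unfolding \<delta>_def by blast
  qed
  have cob: "\<exists>W. W \<subseteq> V - {v0} \<and> (S - S') \<union> (S' - S) = \<delta> W"
    if S: "S \<subseteq> C" "S' \<subseteq> C" "\<Psi> S = \<Psi> S'" for S S'
  proof -
    have eq: "\<phi> S h = \<phi> S' h" if "h \<in> H" for h
      using gen[of S S' h] S(3) that by (auto simp: \<Psi>_def)
    \<comment> \<open>The vertices at which the two potentials differ. Since the homomorphisms agree
      on \<open>H\<close>, the choice of \<open>x\<close> in the vertex does not matter.\<close>
    define W where "W = {(i, v). (i, v) \<in> V \<and> (\<exists>x \<in> carrier G. v = dcos G (P i) H x \<and> \<Phi> S i x \<noteq> \<Phi> S' i x)}"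
    have inW: "(i, P i <#> dcos G T H x) \<in> W \<longleftrightarrow> \<Phi> S i x \<noteq> \<Phi> S' i x"
      if x: "x \<in> carrier G" and e: "dcos G T H x \<in> C" for i x
    proof
      have v: "P i <#> dcos G T H x = dcos G (P i) H x"
        by (rule set_mult_dcos[OF P subgroups(3) H T_subset_P x])
      show "(i, P i <#> dcos G T H x) \<in> W" if "\<Phi> S i x \<noteq> \<Phi> S' i x"
        using that x v e by (cases i) (auto simp: W_def V_def)
      assume "(i, P i <#> dcos G T H x) \<in> W"
      then obtain y where y: "y \<in> carrier G" "dcos G (P i) H x = dcos G (P i) H y" "\<Phi> S i y \<noteq> \<Phi> S' i y"
        by (auto simp: W_def v)
      obtain p h where "p \<in> P i" "h \<in> H" "y = p \<otimes> x \<otimes> h" using dcos_eqD[OF P H y(1,2)] .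
      then show "\<Phi> S i x \<noteq> \<Phi> S' i x" using y(3) x \<Phi> eq by auto
    qed
    have 1: "e \<in> (S - S') \<union> (S' - S) \<longleftrightarrow> e \<in> \<delta> W" if "e \<in> C" for e
    proof -
      obtain x where x: "x \<in> carrier G" "e = dcos G T H x" using C \<open>e \<in> C\<close> by blast
      have "e \<in> S \<longleftrightarrow> \<Phi> S False x \<noteq> \<Phi> S True x" "e \<in> S' \<longleftrightarrow> \<Phi> S' False x \<noteq> \<Phi> S' True x"
        using \<Phi>S[OF x(1)] x(2) by auto
      then show ?thesis
        using inW[OF x(1), of True] inW[OF x(1), of False] \<open>e \<in> C\<close> x(2) by (auto simp: \<delta>_def)
    qed
    then have "(S - S') \<union> (S' - S) = \<delta> W"
    proof -
      have "\<delta> W \<subseteq> C" by (auto simp: \<delta>_def)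
      with 1 S show ?thesis by blast
    qed
    moreover have "W \<subseteq> V" by (auto simp: W_def)
    ultimately show ?thesis
      using compl[of W] by (cases "v0 \<in> W") (blast intro: exI[of _ "V - W"])+
  qed
  \<comment> \<open>A fixed representative of the edge sets with the same values on
    \<open>Y\<close>. As \<open>S\<close> is recovered from it and the coboundary of
    \<open>W S\<close>, the pair of \<open>W S\<close> and \<open>\<Psi> S\<close> encodes
    \<open>S\<close>.\<close>
  define S0 where "S0 S = (SOME S'. S' \<subseteq> C \<and> \<Psi> S' = \<Psi> S)" for S
  have S0: "S0 S \<subseteq> C \<and> \<Psi> (S0 S) = \<Psi> S" if "S \<subseteq> C" for S
    unfolding S0_def by (rule someI[of _ S]) (use that in simp)
  have "\<forall>S. \<exists>W. S \<subseteq> C \<longrightarrow> W \<subseteq> V - {v0} \<and> (S - S0 S) \<union> (S0 S - S) = \<delta> W"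
    using cob S0 by metis
  then obtain W where W: "\<And>S. S \<subseteq> C \<Longrightarrow> W S \<subseteq> V - {v0} \<and> (S - S0 S) \<union> (S0 S - S) = \<delta> (W S)"
    by metis
  have "inj_on (\<lambda>S. (W S, \<Psi> S)) (Pow C)"
  proof (rule inj_onI)
    fix S S' assume S: "S \<in> Pow C" "S' \<in> Pow C" and "(W S, \<Psi> S) = (W S', \<Psi> S')"
    then have "W S = W S'" "S0 S = S0 S'" by (simp_all add: S0_def)
    then have "(S - S0 S) \<union> (S0 S - S) = (S' - S0 S) \<union> (S0 S - S')" using W S by (metis PowD)
    then show "S = S'" by blast
  qed
  moreover have "(\<lambda>S. (W S, \<Psi> S)) ` Pow C \<subseteq> Pow (V - {v0}) \<times> Pow Y"
    using W by (auto simp: \<Psi>_def)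
  ultimately have "card (Pow C) \<le> card (Pow (V - {v0}) \<times> Pow Y)"
    using finV Y(2) by (intro card_inj_on_le) auto
  then have "(2::nat) ^ card C \<le> 2 ^ (card V - 1 + card Y)"
    using finV Y(2) C(1) v0 by (simp add: card_Pow card_cartesian_product power_add)
  then have "card C \<le> card V - 1 + card Y" by simp
  moreover have "card V = card ((<#>) A ` C) + card ((<#>) B ` C)"
    unfolding V_def using C by (subst card_Un_disjoint) (auto simp: card_cartesian_product)
  moreover have "card V \<noteq> 0" using finV v0 by auto
  ultimately show ?thesis by linarith
qed

section \<open>The projections from the quotient graph of the intersection\<close>

lemma free_action:
  assumes "H \<inter> (inv x <# Q #> x) = {\<one>}" "Q \<subseteq> carrier G"
    and "p \<in> Q" "x \<in> carrier G" "h \<in> H" "h \<in> carrier G" "p \<otimes> x = x \<otimes> h"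
  shows "p = \<one>"
proof -
  have p: "p \<in> carrier G" using assms by blast
  \<comment> \<open>Solving for \<open>h\<close> shows that it is a conjugate of \<open>p\<close>
    and so lies in the trivial intersection.\<close>
  have "inv x \<otimes> p \<otimes> x = inv x \<otimes> (x \<otimes> h)" using assms p by (simp add: m_assoc)
  also have "\<dots> = h" using assms by (simp add: m_assoc[symmetric])
  finally have "h \<in> inv x <# Q #> x" using assms(3) by (auto simp: l_coset_def r_coset_def)
  then have "h = \<one>" using assms by blast
  then show ?thesis using assms p by simp
qed

text \<open>Normalising a representative by \<open>T\<close> on the left gives
  \<open>x \<otimes> h\<close> with \<open>h\<close> in \<open>H\<close>, where
  \<open>h \<otimes> inv k\<close> lies in the conjugate of \<open>T\<close> for some
  \<open>k\<close> in \<open>K\<close>. This element determines the edge: equal values for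
  \<open>h\<close>, \<open>k\<close> and \<open>h'\<close>, \<open>k'\<close> give
  \<open>inv h' \<otimes> h = inv k' \<otimes> k\<close>, an element of
  \<open>H \<inter> K\<close>.\<close>

lemma card_fibre_le:
  assumes T: "finite T" and H: "subgroup H G" and K: "subgroup K G" and x: "x \<in> carrier G"
    and D: "D \<subseteq> dcos G T (H \<inter> K) ` carrier G"
  shows "card {e \<in> D. e <#> H = dcos G T H x \<and> e <#> K = dcos G T K x}
    \<le> card ((inv x <# T #> x) \<inter> (H <#> K))"
proof -
  interpret H: subgroup H G by fact
  interpret K: subgroup K G by fact
  interpret T: subgroup T G by (rule subgroups)
  note HK = subgroups_Inter_pair[OF H K]
  define E where "E = {e \<in> D. e <#> H = dcos G T H x \<and> e <#> K = dcos G T K x}"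
  define good where "good e h k \<longleftrightarrow>
    h \<in> H \<and> k \<in> K \<and> h \<otimes> inv k \<in> inv x <# T #> x \<and> e = dcos G T (H \<inter> K) (x \<otimes> h)" for e h k
  have "\<exists>h k. good e h k" if "e \<in> E" for e
  proof -
    from that have "e \<in> D" and e: "e <#> H = dcos G T H x" "e <#> K = dcos G T K x"
      by (simp_all only: E_def mem_Collect_eq)
    then obtain y where y: "e = dcos G T (H \<inter> K) y" "y \<in> carrier G"
      by (elim imageE[OF subsetD[OF D]])
    have eq: "dcos G T H x = dcos G T H y" "dcos G T K x = dcos G T K y"
      unfolding e[symmetric] y(1) by (rule dcos_set_mult[OF subgroups(3) HK H Int_lower1 y(2)]
        dcos_set_mult[OF subgroups(3) HK K Int_lower2 y(2)])+
    obtain t h where t: "t \<in> T" "h \<in> H" "y = t \<otimes> x \<otimes> h" using dcos_eqD[OF subgroups(3) H y(2) eq(1)] .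
    obtain s k where s: "s \<in> T" "k \<in> K" "y = s \<otimes> x \<otimes> k" using dcos_eqD[OF subgroups(3) K y(2) eq(2)] .
    note c = H.mem_carrier[OF t(2)] K.mem_carrier[OF s(2)] T.mem_carrier[OF t(1)] T.mem_carrier[OF s(1)] x
    have "inv t \<otimes> s \<in> T" using t(1) s(1) by simp
    have "x \<otimes> h = inv t \<otimes> y" unfolding t(3) using c by (simp add: m_assoc[symmetric])
    also have "\<dots> = inv t \<otimes> s \<otimes> x \<otimes> k" unfolding s(3) using c by (simp add: m_assoc)
    finally have xh: "x \<otimes> h = inv t \<otimes> s \<otimes> x \<otimes> k" .
    have "h \<otimes> inv k = inv x \<otimes> (x \<otimes> h) \<otimes> inv k" using c by (simp add: m_assoc[symmetric])
    also have "\<dots> = inv x \<otimes> (inv t \<otimes> s) \<otimes> x" unfolding xh using c by (simp add: m_assoc)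
    finally have "h \<otimes> inv k \<in> inv x <# T #> x"
      using \<open>inv t \<otimes> s \<in> T\<close> by (auto simp: l_coset_def r_coset_def)
    moreover have "e = dcos G T (H \<inter> K) (x \<otimes> h)"
      using dcos_mult[OF subgroups(3) HK, of "x \<otimes> h" t \<one>] t(1) c
      unfolding y(1) t(3) by (simp add: m_assoc subgroup.one_closed[OF HK])
    ultimately show ?thesis unfolding good_def using t(2) s(2) by blast
  qed
  then obtain h k where g: "\<And>e. e \<in> E \<Longrightarrow> good e (h e) (k e)" by metis
  have hk: "h e \<in> H" "k e \<in> K" "h e \<otimes> inv (k e) \<in> inv x <# T #> x"
    and e_eq: "e = dcos G T (H \<inter> K) (x \<otimes> h e)" if "e \<in> E" for e
    using g[OF that] unfolding good_def by blast+
  have "card E \<le> card ((inv x <# T #> x) \<inter> (H <#> K))"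
  proof (rule card_inj_on_le)
    show "inj_on (\<lambda>e. h e \<otimes> inv (k e)) E"
    proof (rule inj_onI)
      fix e e' assume e: "e \<in> E" "e' \<in> E" and eq: "h e \<otimes> inv (k e) = h e' \<otimes> inv (k e')"
      have c: "h e \<in> carrier G" "k e \<in> carrier G" "h e' \<in> carrier G" "k e' \<in> carrier G"
        using hk(1,2)[OF e(1)] hk(1,2)[OF e(2)] by simp_all
      define l where "l = inv (h e') \<otimes> h e"
      have "l = inv (h e') \<otimes> (h e \<otimes> inv (k e)) \<otimes> k e" using c by (simp add: l_def m_assoc)
      also have "\<dots> = inv (k e') \<otimes> k e" unfolding eq using c by (simp add: m_assoc[symmetric])
      finally have "l \<in> H \<inter> K" using hk(1,2)[OF e(1)] hk(1,2)[OF e(2)] by (metis IntI H.m_closed H.m_inv_closed K.m_closed K.m_inv_closed l_def)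
      moreover have "x \<otimes> h e = \<one> \<otimes> (x \<otimes> h e') \<otimes> l" using c x by (simp add: l_def m_assoc) (simp add: m_assoc[symmetric])
      ultimately have "dcos G T (H \<inter> K) (x \<otimes> h e) = dcos G T (H \<inter> K) (x \<otimes> h e')"
        using dcos_mult[OF subgroups(3) HK, of "x \<otimes> h e'" \<one> l] c x by simp
      from trans[OF trans[OF e_eq[OF e(1)] this] sym[OF e_eq[OF e(2)]]] show "e = e'" .
    qed
    show "(\<lambda>e. h e \<otimes> inv (k e)) ` E \<subseteq> (inv x <# T #> x) \<inter> (H <#> K)"
    proof (intro image_subsetI IntI)
      fix e assume e: "e \<in> E"
      show "h e \<otimes> inv (k e) \<in> inv x <# T #> x" using hk(3)[OF e] .
      have "inv (k e) \<in> K" using hk(2)[OF e] by simp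
      then show "h e \<otimes> inv (k e) \<in> H <#> K" using hk(1)[OF e] unfolding set_mult_def by blast
    qed
    have "inv x <# T #> x = (\<lambda>t. inv x \<otimes> t \<otimes> x) ` T" by (auto simp: l_coset_def r_coset_def)
    then show "finite ((inv x <# T #> x) \<inter> (H <#> K))" using T by simp
  qed
  then show ?thesis by (simp only: E_def)
qed

text \<open>Writing \<open>y = p \<otimes> x \<otimes> l = t \<otimes> x \<otimes> h\<close> makes
  \<open>inv t \<otimes> p\<close> fix the coset of \<open>x\<close> modulo \<open>H\<close>.
  Freeness gives \<open>p = t\<close>, so \<open>y\<close> lies in the double coset of
  \<open>x\<close> modulo \<open>T\<close> and \<open>L\<close>.\<close>

lemma locally_injective:
  assumes H: "subgroup H G" and L: "subgroup L G" "L \<subseteq> H"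
    and Q: "subgroup Q G" "T \<subseteq> Q"
    and free: "\<And>p x h. p \<in> Q \<Longrightarrow> x \<in> carrier G \<Longrightarrow> h \<in> H \<Longrightarrow> p \<otimes> x = x \<otimes> h \<Longrightarrow> p = \<one>"
    and e: "e \<in> dcos G T L ` carrier G" "e' \<in> dcos G T L ` carrier G"
    and eq: "Q <#> e = Q <#> e'" "e <#> H = e' <#> H"
  shows "e = e'"
proof -
  interpret H: subgroup H G by fact
  interpret L: subgroup L G by fact
  interpret Q: subgroup Q G by fact
  interpret T: subgroup T G by (rule subgroups)
  obtain x y where x: "x \<in> carrier G" "e = dcos G T L x" and y: "y \<in> carrier G" "e' = dcos G T L y"
    using e by blast
  have 1: "dcos G Q L x = dcos G Q L y"
    using eq(1) x y set_mult_dcos[OF Q(1) subgroups(3) L(1) Q(2)] by simp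
  have 2: "dcos G T H x = dcos G T H y"
    using eq(2) x y dcos_set_mult[OF subgroups(3) L(1) H L(2)] by simp
  obtain p l where p: "p \<in> Q" "l \<in> L" "y = p \<otimes> x \<otimes> l" using dcos_eqD[OF Q(1) L(1) y(1) 1] .
  obtain t h where t: "t \<in> T" "h \<in> H" "y = t \<otimes> x \<otimes> h" using dcos_eqD[OF subgroups(3) H y(1) 2] .
  note c = x(1) y(1) Q.mem_carrier[OF p(1)] L.mem_carrier[OF p(2)] T.mem_carrier[OF t(1)] H.mem_carrier[OF t(2)]
  have "inv t \<otimes> p \<otimes> x = inv t \<otimes> y \<otimes> inv l" unfolding p(3) using c by (simp add: m_assoc)
  also have "\<dots> = x \<otimes> (h \<otimes> inv l)" unfolding t(3) using c by (simp add: m_assoc[symmetric])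
  finally have "inv t \<otimes> p = \<one>"
    using free[of "inv t \<otimes> p" x "h \<otimes> inv l"] p(1,2) t(1,2) x(1) L(2) Q(2) by (simp add: subset_iff)
  then have "p = t" using c by (metis inv_equality inv_inv inv_closed)
  then show ?thesis using dcos_mult[OF subgroups(3) L(1) x(1) t(1) p(2)] p(3) x(2) y(2) by simp
qed

end

section \<open>Free bases\<close>

definition cancels :: "'a \<times> bool \<Rightarrow> 'a \<times> bool \<Rightarrow> bool" where
  "cancels k l \<longleftrightarrow> fst k = fst l \<and> snd k \<noteq> snd l"

definition flip :: "'a \<times> bool \<Rightarrow> 'a \<times> bool" where
  "flip l = (fst l, \<not> snd l)"

text \<open>Left multiplication by a letter in the free group, carried out on reduced words.\<close>

definition push :: "'a \<times> bool \<Rightarrow> ('a \<times> bool) list \<Rightarrow> ('a \<times> bool) list" where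
  "push l w = (if w \<noteq> [] \<and> cancels l (hd w) then tl w else l # w)"

lemma flip_flip [simp]: "flip (flip l) = l" and fst_flip [simp]: "fst (flip l) = fst l"
  by (simp_all add: flip_def)

lemma cancels_iff: "cancels k l \<longleftrightarrow> l = flip k"
  by (cases k; cases l) (auto simp: cancels_def flip_def)

lemma Nil_reduced [simp]: "[] \<in> reduced_words X"
  by (simp add: reduced_words_def)

lemma Cons_reduced:
  "l # w \<in> reduced_words X \<longleftrightarrow>
    fst l \<in> X \<and> w \<in> reduced_words X \<and> (w = [] \<or> \<not> cancels l (hd w))"
  by (cases l; cases w) (auto simp: reduced_words_def cancels_def)

lemma push_reduced: "fst l \<in> X \<Longrightarrow> w \<in> reduced_words X \<Longrightarrow> push l w \<in> reduced_words X"
  by (cases w) (auto simp: push_def Cons_reduced)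

lemma push_flip: "w \<in> reduced_words X \<Longrightarrow> push (flip l) (push l w) = w"
  by (cases w; cases "tl w") (auto simp: push_def Cons_reduced cancels_iff)

lemma push_Cons: "l # w \<in> reduced_words X \<Longrightarrow> push l w = l # w"
  by (auto simp: push_def Cons_reduced)

lemma word_val_push:
  assumes "group F" "X \<subseteq> carrier F" "fst l \<in> X" "w \<in> reduced_words X"
  shows "word_val F (push l w) = letter_val F l \<otimes>\<^bsub>F\<^esub> word_val F w"
proof -
  interpret F: group F by fact
  interpret id: group_hom F F id by standard (auto simp: hom_def)
  have cl: "w \<in> lists (carrier F \<times> UNIV)" if "w \<in> reduced_words X" for w
    using that assms(2) by (auto simp: reduced_words_def)
  show ?thesis
  proof (cases "w \<noteq> [] \<and> cancels l (hd w)")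
    case True
    then obtain v where w: "w = flip l # v" by (cases w) (auto simp: cancels_iff)
    then have "word_val F v \<in> carrier F"
      using assms(4) cl id.word_val_closed by (auto simp: Cons_reduced)
    then show ?thesis using assms(2,3) w
      by (auto simp: push_def cancels_iff letter_val_def flip_def F.m_assoc[symmetric])
  next
    case False
    then show ?thesis by (auto simp: push_def)
  qed
qed

text \<open>The restriction makes the function extensional, as the elements of
  \<open>BijGroup\<close> have to be.\<close>

definition push_perm :: "'a set \<Rightarrow> 'a \<times> bool \<Rightarrow> ('a \<times> bool) list \<Rightarrow> ('a \<times> bool) list" where
  "push_perm X l = restrict (push l) (reduced_words X)"

lemma push_perm_Bij:
  assumes "fst l \<in> X"
  shows "push_perm X l \<in> carrier (BijGroup (reduced_words X))"
proof -
  have "bij_betw (push l) (reduced_words X) (reduced_words X)"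
    by (rule bij_betw_byWitness[of _ "push (flip l)"])
      (use assms push_reduced[of l X] push_reduced[of "flip l" X] push_flip[of _ X l] push_flip[of _ X "flip l"] in auto)
  then show ?thesis
    by (simp add: BijGroup_def Bij_def push_perm_def bij_betw_restrict_eq)
qed

lemma push_perm_mult_flip:
  assumes "fst l \<in> X"
  shows "push_perm X (flip l) \<otimes>\<^bsub>BijGroup (reduced_words X)\<^esub> push_perm X l
    = \<one>\<^bsub>BijGroup (reduced_words X)\<^esub>"
proof -
  have "push_perm X l \<in> Bij (reduced_words X)" "push_perm X (flip l) \<in> Bij (reduced_words X)"
    using push_perm_Bij[of l X] push_perm_Bij[of "flip l" X] assms by (simp_all add: BijGroup_def)
  then show ?thesis
    using assms push_reduced[of l X] push_flip[of _ X l]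
    by (auto simp: BijGroup_def compose_def push_perm_def intro!: restrict_ext)
qed

text \<open>Van der Waerden's argument: a hom into the permutations of the reduced words that sends each
  generator to its left multiplication separates the values of the reduced words.\<close>

lemma free_basisI:
  assumes F: "group F" and X: "X \<subseteq> carrier F"
    and gen: "\<And>R. \<one>\<^bsub>F\<^esub> \<in> R \<Longrightarrow> (\<And>l r. fst l \<in> X \<Longrightarrow> r \<in> R \<Longrightarrow> letter_val F l \<otimes>\<^bsub>F\<^esub> r \<in> R) \<Longrightarrow>
      carrier F \<subseteq> R"
    and \<phi>: "\<phi> \<in> hom F (BijGroup (reduced_words X))"
    and \<phi>X: "\<And>x. x \<in> X \<Longrightarrow> \<phi> x = push_perm X (x, True)"
  shows "free_basis F X"
proof -
  let ?R = "reduced_words X"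
  interpret F: group F by fact
  interpret \<phi>: group_hom F "BijGroup ?R" \<phi>
    using F \<phi> group_BijGroup by (simp add: group_hom_def group_hom_axioms_def)
  have cl: "w \<in> lists (carrier F \<times> UNIV)" if "w \<in> ?R" for w
    using that X by (auto simp: reduced_words_def)
  have letter: "\<phi> (letter_val F l) = push_perm X l" if "fst l \<in> X" for l
  proof (cases "snd l")
    case True
    then show ?thesis using \<phi>X[OF that] by (cases l) (simp add: letter_val_def)
  next
    case False
    then have l: "l = flip (fst l, True)" by (cases l) (simp add: flip_def)
    have "push_perm X l = inv\<^bsub>BijGroup ?R\<^esub> push_perm X (fst l, True)"
      using push_perm_mult_flip[of "(fst l, True)" X] push_perm_Bij[of "(fst l, True)" X] push_perm_Bij[of l X] that
      by (intro \<phi>.H.inv_equality[symmetric]) (simp_all flip: l)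
    then show ?thesis using \<phi>X[OF that] that X False by (auto simp: letter_val_def)
  qed
  \<comment> \<open>Applied to the empty word, the permutation belonging to the value of a word
    returns the word itself, whence injectivity.\<close>
  have eval: "\<phi> (word_val F w) [] = w" if "w \<in> ?R" for w
    using that
  proof (induction w)
    case Nil
    then show ?case by (simp add: BijGroup_def)
  next
    case (Cons l w)
    then have l: "fst l \<in> X" and w: "w \<in> ?R" by (simp_all add: Cons_reduced)
    have c: "letter_val F l \<in> carrier F" "word_val F w \<in> carrier F"
      using l X \<phi>.letter_val_closed[of l] \<phi>.word_val_closed[OF cl[OF w]] by (auto simp: mem_Times_iff)
    have "\<phi> (word_val F (l # w)) [] = (push_perm X l \<otimes>\<^bsub>BijGroup ?R\<^esub> \<phi> (word_val F w)) []"
      using c letter[OF l] by simp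
    also have "\<dots> = push_perm X l (\<phi> (word_val F w) [])"
      using push_perm_Bij[OF l] \<phi>.hom_closed[OF c(2)] by (simp add: BijGroup_def compose_def)
    also have "\<dots> = l # w"
      using Cons.IH[OF w] w push_Cons[OF Cons.prems] by (simp add: push_perm_def)
    finally show ?case .
  qed
  have inj: "inj_on (word_val F) ?R"
    by (rule inj_onI) (metis eval)
  \<comment> \<open>Surjectivity: the values of reduced words contain \<open>\<one>\<close> and are
    stable under left multiplication by letters, since \<open>push\<close> keeps words
    reduced.\<close>
  have "carrier F \<subseteq> word_val F ` ?R"
  proof (rule gen)
    show "\<one>\<^bsub>F\<^esub> \<in> word_val F ` ?R" by (rule image_eqI[of _ _ "[]"]) simp_all
    fix l :: "'a \<times> bool" and r assume l: "fst l \<in> X" and "r \<in> word_val F ` ?R"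
    then obtain w where w: "w \<in> ?R" "r = word_val F w" by blast
    show "letter_val F l \<otimes>\<^bsub>F\<^esub> r \<in> word_val F ` ?R"
      unfolding w(2) word_val_push[OF F X l w(1), symmetric] using push_reduced[OF l w(1)] by (rule imageI)
  qed
  moreover have "word_val F ` ?R \<subseteq> carrier F" using \<phi>.word_val_closed cl by blast
  ultimately show ?thesis using F X inj by (simp add: free_basis_def bij_betw_def)
qed

section \<open>A spanning tree of the quotient graph\<close>

text \<open>The assumption \<open>free\<close> expresses the trivial intersections with conjugates
  of the factors as freeness of the action of each factor on the cosets of \<open>H\<close> by left
  multiplication.\<close>

locale amalgam_free_subgroup = amalgam +
  fixes H
  assumes H: "subgroup H G"
    and free: "\<And>i p x h. p \<in> P i \<Longrightarrow> x \<in> carrier G \<Longrightarrow> h \<in> H \<Longrightarrow> p \<otimes> x = x \<otimes> h \<Longrightarrow> p = \<one>"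
begin

sublocale H: subgroup H G by (rule H)

declare P_simps [simp del]

lemma P_closed [simp]:
  "\<one> \<in> P i" "p \<in> P i \<Longrightarrow> q \<in> P i \<Longrightarrow> p \<otimes> q \<in> P i" "p \<in> P i \<Longrightarrow> inv p \<in> P i"
  using subgroup.one_closed[OF P] subgroup.m_closed[OF P] subgroup.m_inv_closed[OF P] by auto

abbreviation vertex :: "bool \<Rightarrow> 'a \<Rightarrow> 'a set" where
  "vertex i x \<equiv> dcos G (P i) H x"

abbreviation edge :: "'a \<Rightarrow> 'a set" where
  "edge x \<equiv> dcos G T H x"

text \<open>\<open>U n\<close> consists of the elements whose vertex of type \<open>even n\<close> has distance at most \<open>n\<close> from the
  base vertex, the double coset of \<open>\<one>\<close> modulo \<open>A\<close>.\<close>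

primrec U :: "nat \<Rightarrow> 'a set" where
  "U 0 = vertex True \<one>"
| "U (Suc n) = {p \<otimes> x | p x. p \<in> P (odd n) \<and> x \<in> U n}"

lemma U_closed: "x \<in> U n \<Longrightarrow> x \<in> carrier G"
proof (induction n arbitrary: x)
  case 0
  then show ?case using dcos_closed[OF P H one_closed] by auto
qed (use P_carrier in auto)

text \<open>The last factor absorbs \<open>p\<close>, and \<open>U 0\<close> is stable under
  \<open>H\<close>. Thus \<open>U n\<close> is a union of vertices on one side.\<close>

lemma U_invariant:
  assumes "x \<in> U n" "p \<in> P (even n)" "h \<in> H"
  shows "p \<otimes> x \<otimes> h \<in> U n"
  using assms
proof (induction n arbitrary: x p)
  case 0
  then obtain q k where q: "q \<in> P True" "k \<in> H" "x = q \<otimes> \<one> \<otimes> k" by (auto simp: dcos_def)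
  then have "p \<otimes> x \<otimes> h = (p \<otimes> q) \<otimes> \<one> \<otimes> (k \<otimes> h)"
    using 0 P_carrier[of q True] P_carrier[of p True] by (simp add: m_assoc)
  then show ?case using 0 q dcosI[of "p \<otimes> q" "P True" "k \<otimes> h" H \<one>] P_closed(2)[of p True q] by simp
next
  case (Suc n)
  then obtain q y where q: "q \<in> P (odd n)" "y \<in> U n" "x = q \<otimes> y" by auto
  have "p \<otimes> x \<otimes> h = (p \<otimes> q) \<otimes> (\<one> \<otimes> y \<otimes> h)"
    using Suc.prems q P_carrier U_closed by (simp add: m_assoc)
  moreover have "\<one> \<otimes> y \<otimes> h \<in> U n" using Suc.IH[OF q(2), of \<one>] Suc.prems(3) by simp
  moreover have "p \<otimes> q \<in> P (odd n)" using Suc.prems(2) q(1) by simp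
  ultimately show ?case unfolding U.simps by blast
qed

lemma U_Suc: "x \<in> U n \<Longrightarrow> x \<in> U (Suc n)"
  using U_closed[of x n] unfolding U.simps by (intro CollectI exI[of _ \<one>] exI[of _ x] conjI) simp_all

text \<open>The quotient graph is connected: left multiplication by an element of a factor either
  stays at the vertex reached so far or passes to a neighbour of it.\<close>

lemma U_exhaust:
  assumes "x \<in> carrier G"
  obtains n where "x \<in> U n"
proof -
  have step: "\<exists>n. p \<otimes> x \<in> U n" if "p \<in> P i" "x \<in> U n" for p x i n
  proof (cases "i = even n")
    case True
    then have "p \<otimes> x \<otimes> \<one> \<in> U n" using U_invariant[of x n p \<one>] that by simp
    then show ?thesis using that U_closed[OF that(2)] P_carrier[OF that(1)] by auto
  next
    case False
    then have "p \<otimes> x \<in> U (Suc n)" using that by auto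
    then show ?thesis by blast
  qed
  have "\<exists>n. x \<in> U n" using assms
  proof (induction rule: amalgam_induct)
    case one
    show ?case using dcos_self[OF P H one_closed] by (intro exI[of _ 0]) simp
  next
    case (left a x)
    then show ?case using step[of a True x] by (auto simp: P_simps)
  next
    case (right b x)
    then show ?case using step[of b False x] by (auto simp: P_simps)
  qed
  then show thesis using that by blast
qed

text \<open>The distance of \<open>vertex i x\<close> from the base vertex. The parity condition
  selects the side, since \<open>x\<close> lies in one vertex of each side.\<close>

definition depth :: "bool \<Rightarrow> 'a \<Rightarrow> nat" where
  "depth i x = (LEAST n. even n = i \<and> x \<in> U n)"

lemma depth:
  assumes "x \<in> carrier G"
  shows "even (depth i x) = i" "x \<in> U (depth i x)"
proof -
  obtain n where "x \<in> U n" using assms by (rule U_exhaust)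
  then have "\<exists>n. even n = i \<and> x \<in> U n"
    using U_Suc[of x n] by (cases "even n = i") (auto intro: exI[of _ "Suc n"] simp del: U.simps)
  from LeastI_ex[OF this] show "even (depth i x) = i" "x \<in> U (depth i x)"
    unfolding depth_def by auto
qed

lemma depth_le: "x \<in> U n \<Longrightarrow> even n = i \<Longrightarrow> depth i x \<le> n"
  unfolding depth_def by (rule Least_le) simp

lemma depth_mult:
  assumes "p \<in> P i" "x \<in> carrier G" "h \<in> H"
  shows "depth i (p \<otimes> x \<otimes> h) = depth i x"
proof -
  have *: "depth i (p \<otimes> x \<otimes> h) \<le> depth i x" if "p \<in> P i" "x \<in> carrier G" "h \<in> H" for p x h
    using depth[OF that(2), of i] that by (intro depth_le U_invariant) auto
  have "inv p \<otimes> (p \<otimes> x \<otimes> h) \<otimes> inv h = x"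
    using assms P_carrier[OF assms(1)] by (simp add: m_assoc[symmetric]) (simp add: m_assoc)
  then show ?thesis
    using *[OF assms] *[of "inv p" "p \<otimes> x \<otimes> h" "inv h"] assms P_carrier[OF assms(1)] by simp
qed

lemma depth_vertex: "x \<in> carrier G \<Longrightarrow> y \<in> vertex i x \<Longrightarrow> depth i y = depth i x"
  using depth_mult by (auto simp: dcos_def)

lemma vertex_eq:
  assumes "x \<in> carrier G" "y \<in> vertex i x"
  shows "vertex i y = vertex i x"
proof -
  obtain p h where "p \<in> P i" "h \<in> H" "y = p \<otimes> x \<otimes> h" using assms(2) by (auto simp: dcos_def)
  then show ?thesis using dcos_mult[OF P H assms(1)] by simp
qed

lemma vertex_closed: "x \<in> carrier G \<Longrightarrow> y \<in> vertex i x \<Longrightarrow> y \<in> carrier G"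
  using dcos_closed[OF P H] by blast

lemma depth_0:
  assumes "x \<in> carrier G" "depth i x = 0"
  shows "i" "vertex i x = vertex True \<one>"
proof -
  show i using depth(1)[OF assms(1), of i] assms(2) by simp
  moreover have "x \<in> vertex True \<one>" using depth(2)[OF assms(1), of i] assms(2) by simp
  ultimately show "vertex i x = vertex True \<one>" using vertex_eq by simp
qed

lemma depth_one: "depth True \<one> = 0"
  using depth_le[of \<one> 0 True] dcos_self[OF P H one_closed] by simp

text \<open>The last step of a shortest walk to the vertex enters it through an edge whose other end
  is one step closer; a representative of that edge serves as \<open>y\<close>.\<close>

lemma ex_parent:
  assumes "x \<in> carrier G" "depth i x \<noteq> 0"
  shows "\<exists>y \<in> vertex i x. depth i y = Suc (depth (\<not> i) y)"
proof -
  obtain n where n: "depth i x = Suc n" using assms(2) not0_implies_Suc by blast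
  have i: "i = odd n" using depth(1)[OF assms(1), of i] n by simp
  obtain p y where p: "p \<in> P i" "y \<in> U n" "x = p \<otimes> y"
    using depth(2)[OF assms(1), of i] n i by auto
  have y: "y \<in> carrier G" using U_closed p(2) .
  have "y = inv p \<otimes> x \<otimes> \<one>" using p y P_carrier by (simp add: m_assoc[symmetric])
  then have v: "y \<in> vertex i x" using p(1) dcosI[of "inv p" "P i" \<one> H x] by simp
  have le: "depth (\<not> i) y \<le> n" using depth_le[OF p(2)] i by simp
  have "y \<in> U (Suc (depth (\<not> i) y))" using depth(2)[OF y] by (rule U_Suc)
  then have "depth i y \<le> Suc (depth (\<not> i) y)"
    using depth(1)[OF y, of "\<not> i"] by (intro depth_le) simp_all
  moreover have "depth i y = Suc n" using depth_vertex[OF assms(1) v] n by simp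
  ultimately show ?thesis using v le by (intro bexI[of _ y]) auto
qed

text \<open>For a vertex \<open>v\<close> other than the base vertex, the double coset of \<open>rep i v\<close> is the edge from \<open>v\<close>
  towards the base vertex.\<close>

definition rep :: "bool \<Rightarrow> 'a set \<Rightarrow> 'a" where
  "rep i v = (if (i, v) = (True, vertex True \<one>) then \<one>
     else SOME y. y \<in> v \<and> depth i y = Suc (depth (\<not> i) y))"

lemma rep_one: "rep True (vertex True \<one>) = \<one>"
  by (simp add: rep_def)

lemma rep_depth:
  assumes "x \<in> carrier G" "depth i x \<noteq> 0"
  shows "depth i x = Suc (depth (\<not> i) (rep i (vertex i x)))"
    and "rep i (vertex i x) \<in> vertex i x"
proof -
  have "(i, vertex i x) \<noteq> (True, vertex True \<one>)"
  proof
    assume eq: "(i, vertex i x) = (True, vertex True \<one>)"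
    have i: "i = True" using eq by (rule Pair_inject)
    have v: "vertex i x = vertex True \<one>" using eq by (rule Pair_inject)
    have "x \<in> vertex True \<one>" unfolding v[symmetric] by (rule dcos_self[OF P H assms(1)])
    with i have "depth i x = 0" using depth_vertex[OF one_closed, of x True] depth_one by simp
    then show False using assms(2) by simp
  qed
  then have r: "rep i (vertex i x) = (SOME y. y \<in> vertex i x \<and> depth i y = Suc (depth (\<not> i) y))"
    unfolding rep_def by (simp only: if_False)
  have "rep i (vertex i x) \<in> vertex i x \<and>
    depth i (rep i (vertex i x)) = Suc (depth (\<not> i) (rep i (vertex i x)))"
    unfolding r by (rule someI_ex) (use ex_parent[OF assms] in blast)
  then show "depth i x = Suc (depth (\<not> i) (rep i (vertex i x)))" "rep i (vertex i x) \<in> vertex i x"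
    using depth_vertex[OF assms(1)] by metis+
qed

lemma rep_vertex:
  assumes "x \<in> carrier G"
  shows "rep i (vertex i x) \<in> vertex i x"
proof (cases "depth i x = 0")
  case True
  show ?thesis using depth_0[OF assms True] rep_one dcos_self[OF P H one_closed, of True] by simp
qed (use rep_depth assms in blast)

lemma rep_carrier: "x \<in> carrier G \<Longrightarrow> rep i (vertex i x) \<in> carrier G"
  using rep_vertex vertex_closed by blast

lemma vertex_rep: "x \<in> carrier G \<Longrightarrow> vertex i (rep i (vertex i x)) = vertex i x"
  using rep_vertex vertex_eq by blast

lemma rep_decompose:
  assumes "x \<in> carrier G"
  obtains p h where "p \<in> P i" "h \<in> H" "x = p \<otimes> rep i (vertex i x) \<otimes> h"
  using dcos_eqD[OF P H assms vertex_rep[OF assms, of i]] by blast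

definition H_part :: "bool \<Rightarrow> 'a \<Rightarrow> 'a \<Rightarrow> 'a" where
  "H_part i y x = (THE h. h \<in> H \<and> (\<exists>p \<in> P i. x = p \<otimes> y \<otimes> h))"

text \<open>If \<open>p\<close> and \<open>q\<close> both occur in such a decomposition,
  \<open>inv q \<otimes> p\<close> fixes the coset of \<open>y\<close>, so \<open>free\<close> makes
  the decomposition unique.\<close>

lemma H_part:
  assumes "p \<in> P i" "h \<in> H" "y \<in> carrier G"
  shows "H_part i y (p \<otimes> y \<otimes> h) = h"
  unfolding H_part_def
proof (rule the_equality)
  show "h \<in> H \<and> (\<exists>q \<in> P i. p \<otimes> y \<otimes> h = q \<otimes> y \<otimes> h)" using assms by blast
  fix k assume "k \<in> H \<and> (\<exists>q \<in> P i. p \<otimes> y \<otimes> h = q \<otimes> y \<otimes> k)"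
  then obtain q where q: "k \<in> H" "q \<in> P i" "p \<otimes> y \<otimes> h = q \<otimes> y \<otimes> k" by blast
  note c = assms P_carrier[OF assms(1)] P_carrier[OF q(2)] q(1)
  have "inv q \<otimes> p \<otimes> y = inv q \<otimes> (p \<otimes> y \<otimes> h) \<otimes> inv h" using c by (simp add: m_assoc)
  also have "\<dots> = y \<otimes> (k \<otimes> inv h)" unfolding q(3) using c by (simp add: m_assoc[symmetric])
  finally have "inv q \<otimes> p = \<one>"
    using free[of "inv q \<otimes> p" i y "k \<otimes> inv h"] c q(2) by simp
  then have "p = q" using c by (metis inv_equality inv_inv inv_closed)
  then show "k = h" using q(3) c by simp
qed

text \<open>Follows the tree path to the base vertex and multiplies the \<open>H\<close>-parts met
  on the way. A vertex at depth \<open>Suc n\<close> is on the side \<open>odd n\<close>, and its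
  \<open>rep\<close> is then read at depth \<open>n\<close> on the other side.\<close>

primrec cocycle_at :: "nat \<Rightarrow> 'a \<Rightarrow> 'a" where
  "cocycle_at 0 x = H_part True \<one> x"
| "cocycle_at (Suc n) x =
    cocycle_at n (rep (odd n) (vertex (odd n) x)) \<otimes> H_part (odd n) (rep (odd n) (vertex (odd n) x)) x"

text \<open>\<open>x \<otimes> inv (S i x)\<close> is the representative of the coset of \<open>x\<close> modulo \<open>H\<close> in the
  lift of the spanning tree, where the coset is regarded as lying on a lift of \<open>vertex i x\<close>.\<close>

definition S :: "bool \<Rightarrow> 'a \<Rightarrow> 'a" where
  "S i x = cocycle_at (depth i x) x"

lemma S_base:
  assumes "x \<in> carrier G" "depth i x = 0" "p \<in> P i" "h \<in> H" "x = p \<otimes> rep i (vertex i x) \<otimes> h"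
  shows "S i x = h"
proof -
  have "S i x = H_part True \<one> x" using assms(2) by (simp add: S_def)
  moreover have "rep i (vertex i x) = \<one>" using depth_0[OF assms(1,2)] rep_one by simp
  then have "x = p \<otimes> \<one> \<otimes> h" using assms(5) by simp
  then have "H_part True \<one> x = h"
    using H_part[of p True h \<one>] assms(3,4) depth_0(1)[OF assms(1,2)] by simp
  ultimately show ?thesis by simp
qed

lemma S_parent:
  assumes x: "x \<in> carrier G" "depth i x \<noteq> 0" and ph: "p \<in> P i" "h \<in> H" "x = p \<otimes> rep i (vertex i x) \<otimes> h"
  shows "S i x = S (\<not> i) (rep i (vertex i x)) \<otimes> h"
proof -
  define y where "y = rep i (vertex i x)"
  have y: "y \<in> carrier G" using rep_carrier[OF x(1)] by (simp add: y_def)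
  have d: "depth i x = Suc (depth (\<not> i) y)" using rep_depth(1)[OF x] by (simp add: y_def)
  have i: "i = odd (depth (\<not> i) y)" using depth(1)[OF y, of "\<not> i"] by auto
  have "S i x = S (\<not> i) y \<otimes> H_part i y x"
    unfolding S_def d cocycle_at.simps i[symmetric] by (simp add: y_def)
  also have "H_part i y x = h"
    using H_part[OF ph(1,2) y] ph(3) by (simp add: y_def)
  finally show ?thesis by (simp add: y_def)
qed

lemma S_closed: "x \<in> carrier G \<Longrightarrow> S i x \<in> H"
proof (induction "depth i x" arbitrary: i x rule: less_induct)
  case less
  obtain p h where ph: "p \<in> P i" "h \<in> H" "x = p \<otimes> rep i (vertex i x) \<otimes> h"
    using rep_decompose[OF less.prems] .
  show ?case
  proof (cases "depth i x = 0")
    case True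
    then show ?thesis using S_base[OF less.prems True ph] ph(2) by simp
  next
    case False
    have "S (\<not> i) (rep i (vertex i x)) \<in> H"
      using less.hyps rep_depth(1)[OF less.prems False] rep_carrier[OF less.prems] by auto
    then show ?thesis using S_parent[OF less.prems False ph] ph(2) by simp
  qed
qed

text \<open>Depth and vertex stay the same; only the first decomposition changes, its
  \<open>H\<close>-part from \<open>h\<close> to \<open>h \<otimes> k\<close>.\<close>

lemma S_mult:
  assumes x: "x \<in> carrier G" and q: "q \<in> P i" and k: "k \<in> H"
  shows "S i (q \<otimes> x \<otimes> k) = S i x \<otimes> k"
proof -
  obtain p h where ph: "p \<in> P i" "h \<in> H" "x = p \<otimes> rep i (vertex i x) \<otimes> h"
    using rep_decompose[OF x] .
  let ?r = "rep i (vertex i x)" and ?x = "q \<otimes> x \<otimes> k"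
  have r: "?r \<in> carrier G" using rep_carrier[OF x] .
  have x': "?x \<in> carrier G" using x q k P_carrier by simp
  have v: "vertex i ?x = vertex i x" using dcos_mult[OF P H x q k] .
  have d: "depth i ?x = depth i x" using depth_mult[OF q x k] .
  have "?x = q \<otimes> (p \<otimes> ?r \<otimes> h) \<otimes> k" using ph(3) by simp
  also have "\<dots> = (q \<otimes> p) \<otimes> ?r \<otimes> (h \<otimes> k)"
    using ph(1,2) r q k P_carrier[of q i] P_carrier[of p i] by (simp add: m_assoc)
  finally have x'_eq: "?x = (q \<otimes> p) \<otimes> rep i (vertex i ?x) \<otimes> (h \<otimes> k)" unfolding v .
  have qp: "q \<otimes> p \<in> P i" and hk: "h \<otimes> k \<in> H" using q k ph by simp_all
  show ?thesis
  proof (cases "depth i x = 0")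
    case True
    then show ?thesis using S_base[OF x True ph] S_base[OF x' _ qp hk x'_eq] d by simp
  next
    case False
    then show ?thesis
      using S_parent[OF x False ph] S_parent[OF x' _ qp hk x'_eq] d v ph(2) k S_closed[OF r, of "\<not> i"]
      by (simp add: m_assoc)
  qed
qed

lemma S_one: "S True \<one> = \<one>"
  using S_base[OF one_closed depth_one, of \<one> \<one>] rep_one by simp

text \<open>The representative decomposes with trivial \<open>p\<close> and \<open>h\<close>, so
  crossing its edge changes nothing.\<close>

lemma S_rep:
  assumes x: "x \<in> carrier G" "depth i x \<noteq> 0"
  shows "S i (rep i (vertex i x)) = S (\<not> i) (rep i (vertex i x))"
proof -
  let ?r = "rep i (vertex i x)"
  have r: "?r \<in> carrier G" using rep_carrier[OF x(1)] .
  have v: "vertex i ?r = vertex i x" using vertex_rep[OF x(1)] .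
  have "depth i ?r \<noteq> 0" using x depth_vertex[OF x(1) rep_vertex[OF x(1)]] by simp
  from S_parent[OF r this, of \<one> \<one>] r v S_closed[OF r, of "\<not> i"] show ?thesis by simp
qed

definition tree :: "'a set set" where
  "tree = {edge (rep i (vertex i x)) | i x. x \<in> carrier G \<and> depth i x \<noteq> 0}"

text \<open>The element of \<open>H\<close> by which the tree representatives of the coset of
  \<open>x\<close> at the two ends of its edge differ. It corresponds to the loop that runs through
  the tree except for this edge.\<close>

definition edge_gen :: "'a \<Rightarrow> 'a" where
  "edge_gen x = S False x \<otimes> inv (S True x)"

lemma edge_gen_closed: "x \<in> carrier G \<Longrightarrow> edge_gen x \<in> H"
  using S_closed by (simp add: edge_gen_def)

lemma edge_gen_cong:
  assumes "x \<in> carrier G" "y \<in> carrier G" "edge x = edge y"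
  shows "edge_gen x = edge_gen y"
proof -
  obtain t h where t: "t \<in> T" "h \<in> H" "y = t \<otimes> x \<otimes> h"
    using dcos_eqD[OF subgroups(3) H assms(2,3)] .
  have "S i y = S i x \<otimes> h" for i
    unfolding t(3) using t(1) T_subset_P by (intro S_mult assms t) blast
  then show ?thesis using assms(1) t(2) S_closed[of x] H.mem_carrier
    by (simp add: edge_gen_def inv_mult_group m_assoc) (simp add: m_assoc[symmetric])
qed

lemma edge_gen_tree:
  assumes "x \<in> carrier G" "edge x \<in> tree"
  shows "edge_gen x = \<one>"
proof -
  obtain i z where z: "z \<in> carrier G" "depth i z \<noteq> 0" "edge x = edge (rep i (vertex i z))"
    using assms(2) by (auto simp: tree_def)
  let ?r = "rep i (vertex i z)"
  have r: "?r \<in> carrier G" using rep_carrier[OF z(1)] .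
  have "edge_gen x = edge_gen ?r" using edge_gen_cong[OF assms(1) r z(3)] .
  also have "S False ?r = S True ?r" using S_rep[OF z(1,2)] by (cases i) simp_all
  then have "edge_gen ?r = \<one>" using S_closed[OF r] by (simp add: edge_gen_def)
  finally show ?thesis .
qed

text \<open>With trivial labels on the tree, the potential equals \<open>\<phi> (S i x)\<close>, by
  induction on the depth. Comparing both ends of an edge then gives its label as the value at its
  generator.\<close>

lemma hom_edge_gen:
  assumes L: "group L" and l: "\<And>e. l e \<in> carrier L" and l_tree: "\<And>e. e \<in> tree \<Longrightarrow> l e = \<one>\<^bsub>L\<^esub>"
  obtains \<phi> where "\<phi> \<in> hom (G\<lparr>carrier := H\<rparr>) L" "\<And>x. x \<in> carrier G \<Longrightarrow> \<phi> (edge_gen x) = l (edge x)"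
proof -
  interpret L: group L by fact
  obtain \<Phi> \<phi> where \<phi>: "\<phi> \<in> hom (G\<lparr>carrier := H\<rparr>) L"
    and \<Phi>c: "\<And>i x. x \<in> carrier G \<Longrightarrow> \<Phi> i x \<in> carrier L"
    and \<Phi>m: "\<And>i p x h. p \<in> P i \<Longrightarrow> x \<in> carrier G \<Longrightarrow> h \<in> H \<Longrightarrow> \<Phi> i (p \<otimes> x \<otimes> h) = \<Phi> i x \<otimes>\<^bsub>L\<^esub> \<phi> h"
    and \<Phi>l: "\<And>x. x \<in> carrier G \<Longrightarrow> \<Phi> False x = l (edge x) \<otimes>\<^bsub>L\<^esub> \<Phi> True x"
    and \<Phi>1: "\<Phi> True \<one> = \<one>\<^bsub>L\<^esub>"
    by (rule edge_potential[OF H L, of l]) (rule l, blast)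
  interpret \<phi>: group_hom "G\<lparr>carrier := H\<rparr>" L \<phi>
    using \<phi> L subgroup_imp_group[OF H] by (simp add: group_hom_def group_hom_axioms_def)
  have \<phi>c: "\<phi> h \<in> carrier L" if "h \<in> H" for h using \<phi>.hom_closed that by simp
  have \<phi>m: "\<phi> (h \<otimes> k) = \<phi> h \<otimes>\<^bsub>L\<^esub> \<phi> k" if "h \<in> H" "k \<in> H" for h k
    using \<phi>.hom_mult that by simp
  have *: "\<Phi> i x = \<phi> (S i x)" if "x \<in> carrier G" for i x
    using that
  proof (induction "depth i x" arbitrary: i x rule: less_induct)
    case less
    note x = less.prems
    obtain p h where ph: "p \<in> P i" "h \<in> H" "x = p \<otimes> rep i (vertex i x) \<otimes> h"
      using rep_decompose[OF x] .
    let ?r = "rep i (vertex i x)"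
    have r: "?r \<in> carrier G" using rep_carrier[OF x] .
    have 1: "\<Phi> i x = \<Phi> i ?r \<otimes>\<^bsub>L\<^esub> \<phi> h" using \<Phi>m[OF ph(1) r ph(2)] ph(3) by simp
    show ?case
    proof (cases "depth i x = 0")
      case True
      then have "\<Phi> i ?r = \<one>\<^bsub>L\<^esub>" using depth_0[OF x True] rep_one \<Phi>1 by simp
      then show ?thesis using 1 S_base[OF x True ph] \<phi>c ph(2) by simp
    next
      case False
      have "edge ?r \<in> tree" using x False unfolding tree_def by blast
      then have "\<Phi> False ?r = \<Phi> True ?r" using \<Phi>l[OF r] l_tree \<Phi>c[OF r] by simp
      then have "\<Phi> i ?r = \<Phi> (\<not> i) ?r" by (cases i) simp_all
      also have "\<dots> = \<phi> (S (\<not> i) ?r)" using less.hyps[of "\<not> i" ?r] rep_depth(1)[OF x False] r by simp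
      finally show ?thesis
        using 1 S_parent[OF x False ph] \<phi>m[OF S_closed[OF r] ph(2)] by simp
    qed
  qed
  show thesis
  proof (rule that[OF \<phi>])
    fix x assume x: "x \<in> carrier G"
    have "\<phi> (edge_gen x) \<otimes>\<^bsub>L\<^esub> \<phi> (S True x) = \<phi> (S False x)"
      using \<phi>m[OF edge_gen_closed[OF x] S_closed[OF x, of True]] S_closed[OF x]
      by (simp add: edge_gen_def m_assoc)
    then have "\<phi> (edge_gen x) \<otimes>\<^bsub>L\<^esub> \<Phi> True x = l (edge x) \<otimes>\<^bsub>L\<^esub> \<Phi> True x"
      using \<Phi>l[OF x] *[OF x] by simp
    then show "\<phi> (edge_gen x) = l (edge x)"
      using \<phi>c[OF edge_gen_closed[OF x]] l \<Phi>c[OF x] by simp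
  qed
qed

definition basis :: "'a set" where
  "basis = edge_gen ` {x \<in> carrier G. edge x \<notin> tree}"

lemma free_basis_basis: "free_basis (G\<lparr>carrier := H\<rparr>) basis"
proof -
  let ?H = "G\<lparr>carrier := H\<rparr>" and ?L = "BijGroup (reduced_words basis)"
  \<comment> \<open>Each edge outside the tree is labelled by the left multiplication with its
    generator; the choice of \<open>x\<close> is harmless by \<open>edge_gen_cong\<close>.\<close>
  define l where "l e = (if e \<in> edge ` carrier G - tree
      then push_perm basis (edge_gen (SOME x. x \<in> carrier G \<and> e = edge x), True) else \<one>\<^bsub>?L\<^esub>)" for e
  have l_edge: "l (edge x) = push_perm basis (edge_gen x, True)"
    if x: "x \<in> carrier G" "edge x \<notin> tree" for x
  proof -
    define y where "y = (SOME y. y \<in> carrier G \<and> edge x = edge y)"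
    have y: "y \<in> carrier G \<and> edge x = edge y"
      unfolding y_def by (rule someI[of _ x]) (use x in simp)
    then have "edge_gen y = edge_gen x" using edge_gen_cong x by metis
    then show ?thesis using x by (simp add: l_def flip: y_def)
  qed
  have L: "group ?L" by (rule group_BijGroup)
  have "l e \<in> carrier ?L" for e
  proof (cases "e \<in> edge ` carrier G - tree")
    case True
    then obtain x where x: "x \<in> carrier G" "e = edge x" "edge x \<notin> tree" by blast
    then show ?thesis using l_edge[OF x(1,3)] by (auto intro!: push_perm_Bij simp: basis_def)
  next
    case False
    then show ?thesis
      using monoid.one_closed[OF group.is_monoid[OF L]] unfolding l_def by (simp only: if_False)
  qed
  moreover have "l e = \<one>\<^bsub>?L\<^esub>" if "e \<in> tree" for e using that by (simp add: l_def)
  ultimately obtain \<phi> where \<phi>: "\<phi> \<in> hom ?H ?L" "\<And>x. x \<in> carrier G \<Longrightarrow> \<phi> (edge_gen x) = l (edge x)"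
    using hom_edge_gen[OF L, of l] by blast
  show ?thesis
  proof (rule free_basisI[OF _ _ _ \<phi>(1)])
    show gH: "group ?H" by (rule subgroup_imp_group[OF H])
    show "basis \<subseteq> carrier ?H" using edge_gen_closed by (auto simp: basis_def)
    show "\<phi> x = push_perm basis (x, True)" if "x \<in> basis" for x
      using that \<phi>(2) l_edge by (auto simp: basis_def)
    fix R assume one: "\<one>\<^bsub>?H\<^esub> \<in> R"
      and step: "\<And>l r. fst l \<in> basis \<Longrightarrow> r \<in> R \<Longrightarrow> letter_val ?H l \<otimes>\<^bsub>?H\<^esub> r \<in> R"
    have inv_H: "inv\<^bsub>?H\<^esub> h = inv h" if "h \<in> H" for h using m_inv_consistent[OF H that] .
    have mult: "edge_gen x \<otimes> r \<in> R \<and> inv (edge_gen x) \<otimes> r \<in> R"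
      if x: "x \<in> carrier G" and r: "r \<in> R" "r \<in> carrier G" for x r
    proof (cases "edge x \<in> tree")
      case True
      then show ?thesis using edge_gen_tree[OF x] r by simp
    next
      case False
      then have "edge_gen x \<in> basis" using x by (auto simp: basis_def)
      then show ?thesis
        using step[of "(edge_gen x, True)", OF _ r(1)] step[of "(edge_gen x, False)", OF _ r(1)] inv_H[OF edge_gen_closed[OF x]]
        by (simp add: letter_val_def)
    qed
    have SF: "S False x = edge_gen x \<otimes> S True x" "S True x = inv (edge_gen x) \<otimes> S False x" if "x \<in> carrier G" for x
      using S_closed[OF that] by (simp_all add: edge_gen_def inv_mult_group m_assoc)
    \<comment> \<open>Along a word, letters of \<open>A\<close> fix \<open>S True\<close>, letters
      of \<open>B\<close> fix \<open>S False\<close>, and the two differ by an edge generator, under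
      which \<open>R\<close> is stable. Taking \<open>x\<close> in \<open>H\<close> gives all of
      \<open>H\<close>, as there \<open>S True\<close> is the identity.\<close>
    have "S True x \<in> R" if "x \<in> carrier G" for x
      using that
    proof (induction rule: amalgam_induct)
      case one
      then show ?case using S_one \<open>\<one>\<^bsub>?H\<^esub> \<in> R\<close> by simp
    next
      case (left a x)
      then show ?case using S_mult[of x a True \<one>] S_closed[of x True] A_carrier by (simp add: P_simps)
    next
      case (right b x)
      then have bx: "b \<otimes> x \<in> carrier G" using B_carrier by simp
      have "S False x \<in> R" using SF(1)[OF right(2)] mult[OF right(2,3)] S_closed[OF right(2), of True] by simp
      moreover have "S False (b \<otimes> x) = S False x"
        using S_mult[of x b False \<one>] S_closed[of x False] right B_carrier by (simp add: P_simps)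
      ultimately show ?case using SF(2)[OF bx] mult[OF bx] S_closed[OF bx, of False] by simp
    qed
    moreover have "S True h = h" if "h \<in> H" for h
      using S_mult[of \<one> \<one> True h] S_one that by simp
    ultimately show "carrier ?H \<subseteq> R" by (auto; metis H.mem_carrier)
  qed
qed

text \<open>The tree path from the vertex to the base vertex, collected by induction on the depth,
  is a finite set closed under passing to parents.\<close>

lemma ancestors:
  assumes "x \<in> carrier G"
  shows "\<exists>W. finite W \<and> (i, vertex i x) \<in> W \<and> (True, vertex True \<one>) \<in> W \<and>
    (\<forall>(j, v) \<in> W. \<exists>y \<in> carrier G. v = vertex j y \<and>
      (depth j y \<noteq> 0 \<longrightarrow> (\<not> j, vertex (\<not> j) (rep j v)) \<in> W))"
  using assms
proof (induction "depth i x" arbitrary: i x rule: less_induct)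
  case less
  note x = less.prems
  show ?case
  proof (cases "depth i x = 0")
    case True
    then show ?thesis using depth_0[OF x True] depth_one
      by (intro exI[of _ "{(True, vertex True \<one>)}"]) auto
  next
    case False
    let ?r = "rep i (vertex i x)"
    have r: "?r \<in> carrier G" "depth (\<not> i) ?r < depth i x"
      using rep_carrier[OF x] rep_depth(1)[OF x False] by auto
    obtain W where W: "finite W" "(\<not> i, vertex (\<not> i) ?r) \<in> W" "(True, vertex True \<one>) \<in> W"
      "\<forall>(j, v) \<in> W. \<exists>y \<in> carrier G. v = vertex j y \<and>
        (depth j y \<noteq> 0 \<longrightarrow> (\<not> j, vertex (\<not> j) (rep j v)) \<in> W)"
      using less.hyps[OF r(2,1)] by blast
    then show ?thesis using x by (intro exI[of _ "insert (i, vertex i x) W"]) fastforce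
  qed
qed

text \<open>The edges of the generators in \<open>Z\<close> are joined with the tree paths from
  their ends to the base vertex. The tree part has one edge fewer than vertices, so the
  \<open>Suc n\<close> further edges leave an excess of \<open>n\<close>.\<close>

lemma subgraph_of_basis:
  assumes Z: "finite Z" "Z \<subseteq> basis" "card Z = Suc n"
  obtains D where "finite D" "D \<subseteq> edge ` carrier G"
    "card ((<#>) A ` D) + card ((<#>) B ` D) + n \<le> card D"
proof -
  have "\<forall>z \<in> Z. \<exists>x. x \<in> carrier G \<and> edge x \<notin> tree \<and> edge_gen x = z"
    using Z(2) by (auto simp: basis_def)
  then obtain f where f: "\<And>z. z \<in> Z \<Longrightarrow> f z \<in> carrier G \<and> edge (f z) \<notin> tree \<and> edge_gen (f z) = z"
    by metis
  let ?N = "(\<lambda>z. edge (f z)) ` Z" and ?base = "(True, vertex True \<one>)"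
  have "inj_on (\<lambda>z. edge (f z)) Z" by (rule inj_onI) (metis f edge_gen_cong)
  then have N: "card ?N = Suc n" using Z(3) by (simp add: card_image)
  define closed where "closed W \<longleftrightarrow> (\<forall>(j, v) \<in> W. \<exists>y \<in> carrier G. v = vertex j y \<and>
      (depth j y \<noteq> 0 \<longrightarrow> (\<not> j, vertex (\<not> j) (rep j v)) \<in> W))" for W
  have "\<forall>k. \<exists>W. snd k \<in> Z \<longrightarrow> finite W \<and> (fst k, vertex (fst k) (f (snd k))) \<in> W \<and> ?base \<in> W \<and> closed W"
  proof
    fix k
    show "\<exists>W. snd k \<in> Z \<longrightarrow> finite W \<and> (fst k, vertex (fst k) (f (snd k))) \<in> W \<and> ?base \<in> W \<and> closed W"
    proof (cases "snd k \<in> Z")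
      case True
      then have "f (snd k) \<in> carrier G" using f by blast
      from ancestors[OF this, of "fst k"] obtain W where
        "finite W \<and> (fst k, vertex (fst k) (f (snd k))) \<in> W \<and> ?base \<in> W \<and> closed W"
        unfolding closed_def ..
      then show ?thesis by (intro exI[of _ W] impI)
    qed simp
  qed
  from choice[OF this] obtain anc' where anc': "\<forall>k. snd k \<in> Z \<longrightarrow>
    finite (anc' k) \<and> (fst k, vertex (fst k) (f (snd k))) \<in> anc' k \<and> ?base \<in> anc' k \<and> closed (anc' k)" ..
  define anc where "anc i z = anc' (i, z)" for i z
  have anc: "finite (anc i z)" "(i, vertex i (f z)) \<in> anc i z" "?base \<in> anc i z" "closed (anc i z)"
    if "z \<in> Z" for i z
    using anc'[rule_format, of "(i, z)"] that by (simp_all add: anc_def)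
  define W where "W = (\<Union>i. \<Union>z \<in> Z. anc i z)"
  have W: "finite W" using Z(1) anc(1) by (simp add: W_def)
  obtain z0 where "z0 \<in> Z" using Z(3) by fastforce
  then have base: "?base \<in> W" using anc(3)[of z0 True] unfolding W_def by blast
  have sub: "anc i z \<subseteq> W" if "z \<in> Z" for i z
    unfolding W_def using that by blast
  have WN: "(i, vertex i (f z)) \<in> W" if "z \<in> Z" for i z
    by (rule subsetD[OF sub[OF that] anc(2)[OF that]])
  have clW: "\<exists>y \<in> carrier G. v = vertex j y \<and> (depth j y \<noteq> 0 \<longrightarrow> (\<not> j, vertex (\<not> j) (rep j v)) \<in> W)"
    if jv: "(j, v) \<in> W" for j v
  proof -
    obtain z i where z: "z \<in> Z" "(j, v) \<in> anc i z" using jv unfolding W_def by blast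
    obtain y where y: "y \<in> carrier G" "v = vertex j y"
      "depth j y \<noteq> 0 \<longrightarrow> (\<not> j, vertex (\<not> j) (rep j v)) \<in> anc i z"
      using bspec[OF anc(4)[OF z(1), of i, unfolded closed_def] z(2)] unfolding prod.case
      by (elim bexE conjE)
    have "depth j y \<noteq> 0 \<longrightarrow> (\<not> j, vertex (\<not> j) (rep j v)) \<in> W"
      using y(3) subsetD[OF sub[OF z(1)]] by iprover
    with y(2) show ?thesis by (intro bexI[OF conjI y(1)])
  qed
  \<comment> \<open>The edge from a vertex towards the base vertex.\<close>
  define pe where "pe = (\<lambda>(i, v). edge (rep i v))"
  have nonbase: "\<exists>y. y \<in> carrier G \<and> v = vertex j y \<and> depth j y \<noteq> 0 \<and> (\<not> j, vertex (\<not> j) (rep j v)) \<in> W"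
    if "(j, v) \<in> W - {?base}" for j v
  proof -
    note jv = DiffD1[OF that] DiffD2[OF that]
    obtain y where y: "y \<in> carrier G" "v = vertex j y"
      "depth j y \<noteq> 0 \<longrightarrow> (\<not> j, vertex (\<not> j) (rep j v)) \<in> W"
      using clW[OF jv(1)] by (elim bexE conjE)
    have "depth j y \<noteq> 0"
    proof
      assume "depth j y = 0"
      from depth_0[OF y(1) this] have "(j, v) = ?base" unfolding y(2) by simp
      with jv(2) show False by simp
    qed
    with y show ?thesis by iprover
  qed
  have endpoint: "P i <#> edge x = vertex i x" if "x \<in> carrier G" for i x
    by (rule set_mult_dcos[OF P subgroups(3) H T_subset_P that])
  \<comment> \<open>A tree edge comes from only one vertex, namely its end of greater depth.\<close>
  have inj: "inj_on pe (W - {?base})"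
  proof (rule inj_onI)
    fix v w assume v: "v \<in> W - {?base}" and w: "w \<in> W - {?base}" and eq: "pe v = pe w"
    obtain i a j b where ij: "v = (i, a)" "w = (j, b)" by (cases v; cases w) auto
    obtain y where y: "y \<in> carrier G" "a = vertex i y" "depth i y \<noteq> 0" using nonbase v ij by blast
    obtain z where z: "z \<in> carrier G" "b = vertex j z" "depth j z \<noteq> 0" using nonbase w ij by blast
    let ?r = "rep i (vertex i y)" and ?s = "rep j (vertex j z)"
    have r: "?r \<in> carrier G" and s: "?s \<in> carrier G" using rep_carrier y z by auto
    have "edge ?r = edge ?s" using eq ij y z by (simp add: pe_def)
    then have v_eq: "vertex k ?r = vertex k ?s" for k using endpoint[OF r] endpoint[OF s] by metis
    have d_eq: "depth k ?r = depth k ?s" for k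
      using depth_vertex[OF s, of ?r k] dcos_self[OF P H r, of k] v_eq[of k] by simp
    have dr: "depth i ?r = Suc (depth (\<not> i) ?r)"
      using rep_depth(1)[OF y(1,3)] depth_vertex[OF y(1) rep_vertex[OF y(1)]] by simp
    have ds: "depth j ?s = Suc (depth (\<not> j) ?s)"
      using rep_depth(1)[OF z(1,3)] depth_vertex[OF z(1) rep_vertex[OF z(1)]] by simp
    have "i = j"
    proof (rule ccontr)
      assume "i \<noteq> j"
      then have "j = (\<not> i)" by auto
      then show False using dr ds d_eq by simp
    qed
    then show "v = w" using v_eq[of i] vertex_rep[OF y(1), of i] vertex_rep[OF z(1), of j] ij y(2) z(2) by simp
  qed
  have parent_tree: "pe v \<in> tree" if "v \<in> W - {?base}" for v
  proof -
    obtain i a where v: "v = (i, a)" by (cases v)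
    then obtain y where "y \<in> carrier G" "a = vertex i y" "depth i y \<noteq> 0" using nonbase \<open>v \<in> _\<close> by blast
    then show ?thesis unfolding v pe_def tree_def by auto
  qed
  let ?D = "?N \<union> pe ` (W - {?base})"
  have "?N \<subseteq> - tree" using f by (intro image_subsetI) simp
  moreover have "pe ` (W - {?base}) \<subseteq> tree" using parent_tree by (rule image_subsetI)
  ultimately have "?N \<inter> pe ` (W - {?base}) = {}" by blast
  then have "card ?D = card ?N + card (pe ` (W - {?base}))"
    using Z(1) W by (intro card_Un_disjoint finite_imageI finite_Diff)
  also have "\<dots> = Suc n + (card W - 1)" using N inj base W by (simp add: card_image)
  also have "\<dots> = card W + n" using card_gt_0_iff[of W] base W by auto
  finally have card_D: "card ?D = card W + n" .
  have end_W: "(i, P i <#> e) \<in> W" if "e \<in> ?D" for i e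
    using that
  proof
    assume "e \<in> ?N"
    then obtain z where z: "z \<in> Z" "e = edge (f z)" by (elim imageE)
    have "f z \<in> carrier G" using f z(1) by blast
    from endpoint[OF this, of i] show ?thesis using WN[OF z(1), of i] z(2) by simp
  next
    assume "e \<in> pe ` (W - {?base})"
    then obtain k where "k \<in> W - {?base}" "e = pe k" by (elim imageE)
    moreover obtain j v where k: "k = (j, v)" by (cases k)
    ultimately have jv: "(j, v) \<in> W - {?base}" "e = edge (rep j v)" by (simp_all add: pe_def)
    obtain y where y: "y \<in> carrier G" "v = vertex j y" "(\<not> j, vertex (\<not> j) (rep j v)) \<in> W"
      using nonbase[OF jv(1)] by (elim exE conjE)
    have e: "P i <#> e = vertex i (rep j v)" using endpoint rep_carrier[OF y(1)] jv(2) y(2) by simp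
    show ?thesis
    proof (cases "i = j")
      case True
      then show ?thesis using e vertex_rep[OF y(1)] y(2) jv(1) by simp
    next
      case False
      then have "i = (\<not> j)" by auto
      then show ?thesis using e y(3) by simp
    qed
  qed
  \<comment> \<open>Tagging the vertices with their side embeds both kinds into
    \<open>W\<close>.\<close>
  have "card ((<#>) A ` ?D) + card ((<#>) B ` ?D) = card (Pair True ` (<#>) A ` ?D \<union> Pair False ` (<#>) B ` ?D)"
    using Z(1) W by (subst card_Un_disjoint) (auto simp: card_image inj_on_def)
  also have "\<dots> \<le> card W"
    using W end_W[of _ True] end_W[of _ False] by (intro card_mono) (auto simp: P_simps)
  finally have 1: "card ((<#>) A ` ?D) + card ((<#>) B ` ?D) + n \<le> card ?D" using card_D by simp
  have 2: "?D \<subseteq> edge ` carrier G"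
  proof
    fix e assume "e \<in> ?D"
    then show "e \<in> edge ` carrier G"
    proof
      assume "e \<in> ?N"
      then show ?thesis using f by blast
    next
      assume "e \<in> pe ` (W - {?base})"
      then have "e \<in> tree" using parent_tree by (elim imageE) simp
      then show ?thesis unfolding tree_def using rep_carrier by (elim CollectE exE conjE) simp
    qed
  qed
  have "finite ?D" using Z(1) W by simp
  then show thesis using that 1 2 by blast
qed

end

section \<open>The rank of the intersection\<close>

context amalgam
begin

text \<open>The bound of \<open>rank_lower_bound\<close> holds for every finite basis, hence for the
  infimum; the reduction by one cancels the summand 1 there.\<close>

lemma reduced_rank_ge:
  assumes H: "subgroup H G" and C: "finite C" "C \<noteq> {}" "C \<subseteq> dcos G T H ` carrier G"
    and k: "card C = k + card ((<#>) A ` C) + card ((<#>) B ` C)"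
  shows "enat k \<le> reduced_rank (G\<lparr>carrier := H\<rparr>)"
proof -
  have "enat (Suc k) \<le> free_rank (G\<lparr>carrier := H\<rparr>)"
    unfolding free_rank_def
  proof (rule INF_greatest)
    fix Y assume "Y \<in> {Y. free_basis (G\<lparr>carrier := H\<rparr>) Y}"
    then show "enat (Suc k) \<le> (if finite Y then enat (card Y) else \<infinity>)"
      using rank_lower_bound[OF H _ _ C, of Y] k by simp
  qed
  then have "enat (Suc k) - 1 \<le> free_rank (G\<lparr>carrier := H\<rparr>) - 1"
    by (cases "free_rank (G\<lparr>carrier := H\<rparr>)") (auto simp: one_enat_def)
  then show ?thesis by (simp add: reduced_rank_def one_enat_def max_def)
qed

lemma amalgam_free_subgroup_mono:
  assumes "amalgam_free_subgroup G A B T H" "subgroup L G" "L \<subseteq> H"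
  shows "amalgam_free_subgroup G A B T L"
proof -
  interpret H: amalgam_free_subgroup G A B T H by fact
  show ?thesis
    using assms(2) H.free subsetD[OF assms(3)] amalgam_axioms
    by (intro amalgam_free_subgroup.intro amalgam_free_subgroup_axioms.intro) blast+
qed

text \<open>Stated for finite subsets of the basis so that it also applies if the basis is infinite.
  A nonzero \<open>n\<close> keeps the pruned graph nonempty, as \<open>reduced_rank_ge\<close>
  requires.\<close>

lemma intersection_bound:
  assumes H: "amalgam_free_subgroup G A B T H" and K: "amalgam_free_subgroup G A B T K"
    and T: "finite T" and m: "\<And>g. g \<in> carrier G \<Longrightarrow> card ((inv g <# T #> g) \<inter> (H <#> K)) \<le> m"
    and Z: "Z \<subseteq> amalgam_free_subgroup.basis G A B T (H \<inter> K)" "finite Z" "card Z = Suc n" and n: "n \<noteq> 0"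
  shows "enat n \<le> 6 * enat m * reduced_rank (G\<lparr>carrier := H\<rparr>) * reduced_rank (G\<lparr>carrier := K\<rparr>)"
proof -
  interpret H: amalgam_free_subgroup G A B T H by (rule H)
  interpret K: amalgam_free_subgroup G A B T K by (rule K)
  note L = subgroups_Inter_pair[OF H.H K.H]
  interpret L: amalgam_free_subgroup G A B T "H \<inter> K"
    using H L by (rule amalgam_free_subgroup_mono) simp
  let ?E = "\<lambda>H. dcos G T H ` carrier G"
  obtain D0 where D0: "finite D0" "D0 \<subseteq> ?E (H \<inter> K)" "card ((<#>) A ` D0) + card ((<#>) B ` D0) + n \<le> card D0"
    using L.subgraph_of_basis[OF Z(2,1,3)] .
  obtain D where D: "D \<subseteq> D0" "card ((<#>) A ` D) + card ((<#>) B ` D) + n \<le> card D"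
    "\<forall>e \<in> D. \<exists>e' \<in> D. e' \<noteq> e \<and> A <#> e' = A <#> e" "\<forall>e \<in> D. \<exists>e' \<in> D. e' \<noteq> e \<and> B <#> e' = B <#> e"
    using prune_leaves[OF D0(1,3)] by (elim exE conjE)
  have fin: "finite D" and DE: "D \<subseteq> ?E (H \<inter> K)"
    using finite_subset[OF D(1) D0(1)] subset_trans[OF D(1) D0(2)] by simp_all
  have ne: "D \<noteq> {}" using D(2) n by force
  have e_sub: "e \<subseteq> carrier G" if "e \<in> D" for e
    using that DE dcos_closed[OF subgroups(3) L] by blast
  have project: "e <#> S \<in> ?E S" if "e \<in> D" "subgroup S G" "H \<inter> K \<subseteq> S" for e S
    using that DE dcos_set_mult[OF subgroups(3) L that(2,3)] by blast
  have pH: "(\<lambda>e. e <#> H) ` D \<subseteq> ?E H" using project[OF _ H.H] by auto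
  have pK: "(\<lambda>e. e <#> K) ` D \<subseteq> ?E K" using project[OF _ K.H] by auto
  have compat: "P i <#> (e <#> S) = P i <#> (e' <#> S)"
    if "e \<in> D" "e' \<in> D" "P i <#> e = P i <#> e'" "S \<subseteq> carrier G" for e e' i S
    using set_mult_assoc[OF subgroup.subset[OF P[of i]] e_sub[OF that(1)] that(4)]
      set_mult_assoc[OF subgroup.subset[OF P[of i]] e_sub[OF that(2)] that(4)] that(3) by metis
  have injH: "e = e'" if "e \<in> D" "e' \<in> D" "P i <#> e = P i <#> e'" "e <#> H = e' <#> H" for e e' i
    by (rule locally_injective[OF H.H L Int_lower1 P[of i] T_subset_P _
      subsetD[OF DE that(1)] subsetD[OF DE that(2)] that(3,4)]) (rule H.free)
  have injK: "e = e'" if "e \<in> D" "e' \<in> D" "P i <#> e = P i <#> e'" "e <#> K = e' <#> K" for e e' i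
    by (rule locally_injective[OF K.H L Int_lower2 P[of i] T_subset_P _
      subsetD[OF DE that(1)] subsetD[OF DE that(2)] that(3,4)]) (rule K.free)
  have fibre: "card {e' \<in> D. e' <#> H = e <#> H \<and> e' <#> K = e <#> K} \<le> m" if "e \<in> D" for e
  proof -
    from subsetD[OF DE that] obtain x where x: "e = dcos G T (H \<inter> K) x" "x \<in> carrier G"
      by (rule imageE)
    have e: "e <#> H = dcos G T H x" "e <#> K = dcos G T K x"
      unfolding x(1) by (rule dcos_set_mult[OF subgroups(3) L H.H Int_lower1 x(2)]
        dcos_set_mult[OF subgroups(3) L K.H Int_lower2 x(2)])+
    show ?thesis unfolding e
      using card_fibre_le[OF T H.H K.H x(2) DE] m[OF x(2)] by (rule order_trans)
  qed
  have count: "2 * card ((<#>) (P i) ` D) \<le> card D"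
    "2 * card ((<#>) (P i) ` (\<lambda>e. e <#> H) ` D) \<le> card ((\<lambda>e. e <#> H) ` D)"
    "2 * card ((<#>) (P i) ` (\<lambda>e. e <#> K) ` D) \<le> card ((\<lambda>e. e <#> K) ` D)"
    "real (card D) - 2 * real (card ((<#>) (P i) ` D)) \<le> 3 * real m *
       ((real (card ((\<lambda>e. e <#> H) ` D)) - 2 * real (card ((<#>) (P i) ` (\<lambda>e. e <#> H) ` D))) *
        (real (card ((\<lambda>e. e <#> K) ` D)) - 2 * real (card ((<#>) (P i) ` (\<lambda>e. e <#> K) ` D))))" for i
  proof -
    note compat' = compat[OF _ _ _ H.H.subset] compat[OF _ _ _ K.H.subset]
    have deg: "\<exists>e' \<in> D. e' \<noteq> e \<and> P i <#> e' = P i <#> e" if "e \<in> D" for e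
      using that D(3,4) by (cases i) (simp_all add: P_simps)
    note * = local_count[where D = D and f = "(<#>) (P i)" and fp = "(<#>) (P i)" and fq = "(<#>) (P i)"
      and p = "\<lambda>e. e <#> H" and q = "\<lambda>e. e <#> K" and m = m, OF fin compat' injH[of _ _ i] injK[of _ _ i] fibre deg]
    show "2 * card ((<#>) (P i) ` D) \<le> card D"
      "2 * card ((<#>) (P i) ` (\<lambda>e. e <#> H) ` D) \<le> card ((\<lambda>e. e <#> H) ` D)"
      "2 * card ((<#>) (P i) ` (\<lambda>e. e <#> K) ` D) \<le> card ((\<lambda>e. e <#> K) ` D)"
      "real (card D) - 2 * real (card ((<#>) (P i) ` D)) \<le> 3 * real m *
       ((real (card ((\<lambda>e. e <#> H) ` D)) - 2 * real (card ((<#>) (P i) ` (\<lambda>e. e <#> H) ` D))) *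
        (real (card ((\<lambda>e. e <#> K) ` D)) - 2 * real (card ((<#>) (P i) ` (\<lambda>e. e <#> K) ` D))))"
      by (rule *; assumption)+
  qed
  note count' = count[of True, unfolded P_simps] count[of False, unfolded P_simps]
  \<comment> \<open>\<open>h\<close> and \<open>k\<close> are the excesses of edges over vertices in
    the two images. The truncated subtraction is exact, since by \<open>count\<close> each side has
    at most half as many vertices as edges.\<close>
  define h where "h = card ((\<lambda>e. e <#> H) ` D) - card ((<#>) A ` (\<lambda>e. e <#> H) ` D) - card ((<#>) B ` (\<lambda>e. e <#> H) ` D)"
  define k where "k = card ((\<lambda>e. e <#> K) ` D) - card ((<#>) A ` (\<lambda>e. e <#> K) ` D) - card ((<#>) B ` (\<lambda>e. e <#> K) ` D)"
  have h: "card ((\<lambda>e. e <#> H) ` D) = h + card ((<#>) A ` (\<lambda>e. e <#> H) ` D) + card ((<#>) B ` (\<lambda>e. e <#> H) ` D)"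
    using count'(2,6) by (simp add: h_def)
  have k: "card ((\<lambda>e. e <#> K) ` D) = k + card ((<#>) A ` (\<lambda>e. e <#> K) ` D) + card ((<#>) B ` (\<lambda>e. e <#> K) ` D)"
    using count'(3,7) by (simp add: k_def)
  \<comment> \<open>The mixed terms are nonnegative, so the estimates for the two sides merge into
    one product.\<close>
  have *: "x1 * y1 + x2 * y2 \<le> (x1 + x2) * (y1 + y2)" if "0 \<le> x1" "0 \<le> x2" "0 \<le> y1" "0 \<le> y2" for x1 x2 y1 y2 :: real
    using that by (simp add: distrib_left distrib_right)
  define x where "x i = real (card ((\<lambda>e. e <#> H) ` D)) - 2 * real (card ((<#>) (P i) ` (\<lambda>e. e <#> H) ` D))" for i
  define y where "y i = real (card ((\<lambda>e. e <#> K) ` D)) - 2 * real (card ((<#>) (P i) ` (\<lambda>e. e <#> K) ` D))" for i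
  have xy: "0 \<le> x i" "0 \<le> y i" for i using count(2,3)[of i] by (simp_all add: x_def y_def)
  have sx: "x True + x False = 2 * real h" using h by (simp add: x_def P_simps)
  have sy: "y True + y False = 2 * real k" using k by (simp add: y_def P_simps)
  have "2 * real n \<le> (real (card D) - 2 * real (card ((<#>) (P True) ` D)))
      + (real (card D) - 2 * real (card ((<#>) (P False) ` D)))"
    using D(2) by (simp add: P_simps)
  also have "\<dots> \<le> 3 * real m * (x True * y True) + 3 * real m * (x False * y False)"
    using count(4)[of True] count(4)[of False] by (simp only: x_def y_def add_mono)
  also have "\<dots> = 3 * real m * (x True * y True + x False * y False)" by (simp add: distrib_left)
  also have "\<dots> \<le> 3 * real m * ((x True + x False) * (y True + y False))"
    using xy by (intro mult_left_mono *) auto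
  \<comment> \<open>Each of the two sides counts all edges, so both sums are twice an excess:
    \<open>3 * (2 * h) * (2 * k)\<close> is \<open>2 * (6 * h * k)\<close>, whence the constant
    6.\<close>
  also have "\<dots> = 2 * real (6 * m * h * k)" unfolding sx sy by simp
  finally have "real n \<le> real (6 * m * h * k)" by linarith
  then have "n \<le> 6 * m * h * k" by (simp only: of_nat_le_iff)
  then have "enat n \<le> enat (6 * m * h * k)" by simp
  also have "\<dots> = 6 * enat m * enat h * enat k" by (simp add: numeral_eq_enat)
  also have "\<dots> \<le> 6 * enat m * reduced_rank (G\<lparr>carrier := H\<rparr>) * reduced_rank (G\<lparr>carrier := K\<rparr>)"
    using reduced_rank_ge[OF H.H _ _ pH h] reduced_rank_ge[OF K.H _ _ pK k] fin ne
    by (intro mult_mono) auto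
  finally show ?thesis .
qed

lemma reduced_rank_intersection:
  assumes H: "amalgam_free_subgroup G A B T H" and K: "amalgam_free_subgroup G A B T K"
    and T: "finite T" and m: "\<And>g. g \<in> carrier G \<Longrightarrow> card ((inv g <# T #> g) \<inter> (H <#> K)) \<le> m"
  shows "reduced_rank (G\<lparr>carrier := H \<inter> K\<rparr>)
    \<le> 6 * enat m * reduced_rank (G\<lparr>carrier := H\<rparr>) * reduced_rank (G\<lparr>carrier := K\<rparr>)" (is "_ \<le> ?R")
proof -
  interpret H: amalgam_free_subgroup G A B T H by (rule H)
  interpret K: amalgam_free_subgroup G A B T K by (rule K)
  note L = subgroups_Inter_pair[OF H.H K.H]
  interpret L: amalgam_free_subgroup G A B T "H \<inter> K"
    using H L by (rule amalgam_free_subgroup_mono) simp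
  note bound = intersection_bound[OF H K T m]
  show ?thesis
  proof (cases "finite L.basis")
    case True
    have "free_rank (G\<lparr>carrier := H \<inter> K\<rparr>) \<le> enat (card L.basis)"
      unfolding free_rank_def using L.free_basis_basis True by (intro INF_lower2[of L.basis]) auto
    then have "free_rank (G\<lparr>carrier := H \<inter> K\<rparr>) - 1 \<le> enat (card L.basis) - 1"
      by (cases "free_rank (G\<lparr>carrier := H \<inter> K\<rparr>)") (auto simp: one_enat_def)
    then have le: "reduced_rank (G\<lparr>carrier := H \<inter> K\<rparr>) \<le> enat (card L.basis - 1)"
      by (simp add: reduced_rank_def one_enat_def max_def)
    show ?thesis
    proof (cases "card L.basis - 1 = 0")
      case True
      then show ?thesis using le by (simp add: zero_enat_def[symmetric])
    next
      case False
      then have "card L.basis = Suc (card L.basis - 1)" by simp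
      from bound[OF _ subset_refl True this False] le show ?thesis by (rule order_trans[rotated])
    qed
  next
    case False
    \<comment> \<open>Finite parts of the basis of every size push the right-hand side above every
      number.\<close>
    have ge: "enat (Suc r) \<le> ?R" for r
    proof -
      obtain Z where "finite Z" "card Z = Suc (Suc r)" "Z \<subseteq> L.basis"
        using infinite_arbitrarily_large[OF False] by blast
      then show ?thesis using bound[of Z "Suc r"] by simp
    qed
    have "?R = \<infinity>"
    proof (rule ccontr)
      assume "?R \<noteq> \<infinity>"
      then obtain r where "?R = enat r" by auto
      then show False using ge[of r] by simp
    qed
    then show ?thesis by simp
  qed
qed

lemma amalgam_free_subgroupI:
  assumes H: "subgroup H G"
    and free: "\<forall>g \<in> carrier G. H \<inter> (inv g <# A #> g) = {\<one>} \<and> H \<inter> (inv g <# B #> g) = {\<one>}"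
  shows "amalgam_free_subgroup G A B T H"
proof (intro amalgam_free_subgroup.intro amalgam_axioms amalgam_free_subgroup_axioms.intro H)
  fix i p x h assume *: "p \<in> P i" "x \<in> carrier G" "h \<in> H" "p \<otimes> x = x \<otimes> h"
  have "H \<inter> (inv x <# P i #> x) = {\<one>}" using free *(2) by (simp add: P_def)
  then show "p = \<one>"
    using subgroup.subset[OF P] *(1,2,3) subgroup.mem_carrier[OF H *(3)] *(4) by (rule free_action)
qed

end

theorem corollary1:
  fixes G :: "('a, 'b) monoid_scheme" (structure)
    and A B T H K :: "'a set"
  assumes "amalgamated_free_product G A B T"
    and "finite T"
    and "fin_gen_subgroup H G"
    and "fin_gen_subgroup K G"
    and "\<forall>g \<in> carrier G. H \<inter> (inv g <# A #> g) = {\<one>} \<and> H \<inter> (inv g <# B #> g) = {\<one>}"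
    and "\<forall>g \<in> carrier G. K \<inter> (inv g <# A #> g) = {\<one>} \<and> K \<inter> (inv g <# B #> g) = {\<one>}"
  shows "free_group (G\<lparr>carrier := H\<rparr>) \<and> free_group (G\<lparr>carrier := K\<rparr>) \<and>
    free_group (G\<lparr>carrier := H \<inter> K\<rparr>) \<and>
    (let m = Max ((\<lambda>g. card ((inv g <# T #> g) \<inter> (H <#> K))) ` carrier G) in
       reduced_rank (G\<lparr>carrier := H \<inter> K\<rparr>)
         \<le> 6 * enat m * reduced_rank (G\<lparr>carrier := H\<rparr>) * reduced_rank (G\<lparr>carrier := K\<rparr>)) \<and>
    reduced_rank (G\<lparr>carrier := H \<inter> K\<rparr>)
      \<le> 6 * enat (card T) * reduced_rank (G\<lparr>carrier := H\<rparr>) * reduced_rank (G\<lparr>carrier := K\<rparr>)"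
proof -
  interpret group G using assms(1) by (simp add: amalgamated_free_product_def)
  interpret amalgam G A B T by unfold_locales (rule assms(1))
  have sub: "subgroup H G" "subgroup K G" using assms(3,4) by (simp_all add: fin_gen_subgroup_def)
  have H: "amalgam_free_subgroup G A B T H" and K: "amalgam_free_subgroup G A B T K"
    using amalgam_free_subgroupI sub assms(5,6) by simp_all
  have L: "amalgam_free_subgroup G A B T (H \<inter> K)"
    using H subgroups_Inter_pair[OF sub] by (rule amalgam_free_subgroup_mono) simp
  have free: "free_group (G\<lparr>carrier := S\<rparr>)" if "amalgam_free_subgroup G A B T S" for S
    using amalgam_free_subgroup.free_basis_basis[OF that] by (auto simp: free_group_def)
  let ?c = "\<lambda>g. card ((inv g <# T #> g) \<inter> (H <#> K))"
  \<comment> \<open>Conjugation does not enlarge \<open>T\<close>. This makes the set under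
    \<open>Max\<close> finite and allows \<open>card T\<close> in place of the maximum.\<close>
  have le: "?c g \<le> card T" for g
  proof -
    have "inv g <# T #> g = (\<lambda>t. inv g \<otimes> t \<otimes> g) ` T" by (auto simp: l_coset_def r_coset_def)
    then have "?c g \<le> card ((\<lambda>t. inv g \<otimes> t \<otimes> g) ` T)" using assms(2) by (simp add: card_mono)
    also have "\<dots> \<le> card T" using assms(2) by (rule card_image_le)
    finally show ?thesis .
  qed
  then have "finite (?c ` carrier G)" by (intro finite_subset[of "?c ` carrier G" "{..card T}"]) auto
  then have "?c g \<le> Max (?c ` carrier G)" if "g \<in> carrier G" for g using that by (intro Max_ge) auto
  then show ?thesis
    using free[OF H] free[OF K] free[OF L] reduced_rank_intersection[OF H K assms(2)] le
    by (simp add: Let_def)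
qed

end
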